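(* The following statement (the Valuation Extension Lemma for $\mathbf{CTL}$) is provable in $\Sigma^1_2$-$\mathrm{DC}_0$: for each serial frame $F=(W,R)$ and each $v:W\times\mathrm{Prop}\to\{0,1\}$, there exists a $\mathbf{CTL}$-valuation $V$ on $(W,R)$ such that $V$ is an extension of $v$.
   Context: Setting: second-order arithmetic. $\Sigma^1_2$-$\mathrm{DC}_0$ is the standard subsystem consisting of $\mathrm{ACA}_0$ together with the scheme of dependent choice for $\Sigma^1_2$ formulas. $\mathrm{Prop}$ is an infinite set of propositional variables. $\mathrm{Fml}_{\mathbf{CTL}}$ is the set of formulas built from $\mathrm{Prop}\cup\{\bot\}$ by $\varphi\to\psi$, $\mathsf{AX}\varphi$, $\mathsf{EG}\varphi$, $\varphi\,\mathsf{EU}\,\psi$, coded as natural numbers. A frame is a pair $(W,R)$ with $W\subseteq\mathbb{N}$ non-empty and $R\subseteq W\times W$; it is serial if $\forall w\in W\exists u\in W(wRu)$. A path from $w$ is a function $f:\mathbb{N}\to W$ with $f(0)=w$ and $f(i)Rf(i+1)$ for all $i$. A $\mathbf{CTL}$-valuation on a serial frame $(W,R)$ is a function (a set in the sense of second-order arithmetic) $V:W\times\mathrm{Fml}_{\mathbf{CTL}}\to\{0,1\}$ such that for all $w,\varphi,\psi$: $V(w,\bot)=0$; $V(w,\varphi\to\psi)=1-V(w,\varphi)(1-V(w,\psi))$; $V(w,\mathsf{AX}\varphi)=1\iff\forall u\in W(wRu\to V(u,\varphi)=1)$; $V(w,\mathsf{EG}\varphi)=1\iff$ there is a path $f$ from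 $w$ with $V(f(i),\varphi)=1$ for all $i\ge0$; $V(w,\varphi\,\mathsf{EU}\,\psi)=1\iff$ there are a path $f$ from $w$ and $i\ge0$ with $V(f(j),\varphi)=1$ for all $j<i$ and $V(f(i),\psi)=1$. *)

theory Defs
  imports Main "HOL-Library.Nat_Bijection"
begin

section \<open>The language of second-order arithmetic\<close>

text \<open>
  Number variables and set variables are both named by strings, but they form two separate
  name spaces. Equality is a primitive between numbers only; as usual, equality of sets is
  extensional and is not part of the language.
\<close>

type_synonym name = string

datatype tm =
    Var name
  | Zero
  | One
  | Plus tm tm   (infixl "\<^bold>+" 65)
  | Times tm tm  (infixl "\<^bold>\<cdot>" 70)

datatype fm =
    Fls          ("\<^bold>\<bottom>")
  | Eq tm tm     (infix "\<^bold>=" 50)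
  | Less tm tm   (infix "\<^bold><" 50)
  | Mem tm name  (infix "\<^bold>\<in>" 50)
  | Imp fm fm    (infixr "\<^bold>\<longrightarrow>" 25)
  | AllN name fm ("(3\<^bold>\<forall>_./ _)" [1000, 10] 10)
  | AllS name fm ("(3\<^bold>\<forall>\<^sub>s_./ _)" [1000, 10] 10)

definition Neg :: "fm \<Rightarrow> fm" ("\<^bold>\<not> _" [40] 40) where
  "(\<^bold>\<not> \<phi>) = (\<phi> \<^bold>\<longrightarrow> \<^bold>\<bottom>)"

definition Or :: "fm \<Rightarrow> fm \<Rightarrow> fm" (infixr "\<^bold>\<or>" 30) where
  "(\<phi> \<^bold>\<or> \<psi>) = (\<^bold>\<not> \<phi> \<^bold>\<longrightarrow> \<psi>)"

definition And :: "fm \<Rightarrow> fm \<Rightarrow> fm" (infixr "\<^bold>\<and>" 35) where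
  "(\<phi> \<^bold>\<and> \<psi>) = (\<^bold>\<not> (\<phi> \<^bold>\<longrightarrow> \<^bold>\<not> \<psi>))"

definition Iff :: "fm \<Rightarrow> fm \<Rightarrow> fm" (infixr "\<^bold>\<longleftrightarrow>" 25) where
  "(\<phi> \<^bold>\<longleftrightarrow> \<psi>) = ((\<phi> \<^bold>\<longrightarrow> \<psi>) \<^bold>\<and> (\<psi> \<^bold>\<longrightarrow> \<phi>))"

definition ExN :: "name \<Rightarrow> fm \<Rightarrow> fm" ("(3\<^bold>\<exists>_./ _)" [1000, 10] 10) where
  "(\<^bold>\<exists>x. \<phi>) = (\<^bold>\<not> (\<^bold>\<forall>x. \<^bold>\<not> \<phi>))"

definition ExS :: "name \<Rightarrow> fm \<Rightarrow> fm" ("(3\<^bold>\<exists>\<^sub>s_./ _)" [1000, 10] 10) where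
  "(\<^bold>\<exists>\<^sub>sX. \<phi>) = (\<^bold>\<not> (\<^bold>\<forall>\<^sub>sX. \<^bold>\<not> \<phi>))"

primrec fv_tm :: "tm \<Rightarrow> name set" where
  "fv_tm (Var x) = {x}"
| "fv_tm Zero = {}"
| "fv_tm One = {}"
| "fv_tm (s \<^bold>+ t) = fv_tm s \<union> fv_tm t"
| "fv_tm (s \<^bold>\<cdot> t) = fv_tm s \<union> fv_tm t"

primrec fvN :: "fm \<Rightarrow> name set" where
  "fvN \<^bold>\<bottom> = {}"
| "fvN (s \<^bold>= t) = fv_tm s \<union> fv_tm t"
| "fvN (s \<^bold>< t) = fv_tm s \<union> fv_tm t"
| "fvN (t \<^bold>\<in> X) = fv_tm t"
| "fvN (\<phi> \<^bold>\<longrightarrow> \<psi>) = fvN \<phi> \<union> fvN \<psi>"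
| "fvN (\<^bold>\<forall>x. \<phi>) = fvN \<phi> - {x}"
| "fvN (\<^bold>\<forall>\<^sub>sX. \<phi>) = fvN \<phi>"

primrec fvS :: "fm \<Rightarrow> name set" where
  "fvS \<^bold>\<bottom> = {}"
| "fvS (s \<^bold>= t) = {}"
| "fvS (s \<^bold>< t) = {}"
| "fvS (t \<^bold>\<in> X) = {X}"
| "fvS (\<phi> \<^bold>\<longrightarrow> \<psi>) = fvS \<phi> \<union> fvS \<psi>"
| "fvS (\<^bold>\<forall>x. \<phi>) = fvS \<phi>"
| "fvS (\<^bold>\<forall>\<^sub>sX. \<phi>) = fvS \<phi> - {X}"

primrec subst_tm :: "tm \<Rightarrow> name \<Rightarrow> tm \<Rightarrow> tm" where
  "subst_tm t x (Var y) = (if y = x then t else Var y)"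
| "subst_tm t x Zero = Zero"
| "subst_tm t x One = One"
| "subst_tm t x (r \<^bold>+ s) = subst_tm t x r \<^bold>+ subst_tm t x s"
| "subst_tm t x (r \<^bold>\<cdot> s) = subst_tm t x r \<^bold>\<cdot> subst_tm t x s"

text \<open>
  The substitutions below replace the free occurrences literally; capture is excluded by the
  predicates \<open>free_forN\<close> and \<open>free_forS\<close>.
\<close>

primrec substN :: "tm \<Rightarrow> name \<Rightarrow> fm \<Rightarrow> fm" where
  "substN t x \<^bold>\<bottom> = \<^bold>\<bottom>"
| "substN t x (r \<^bold>= s) = (subst_tm t x r \<^bold>= subst_tm t x s)"
| "substN t x (r \<^bold>< s) = (subst_tm t x r \<^bold>< subst_tm t x s)"
| "substN t x (r \<^bold>\<in> X) = (subst_tm t x r \<^bold>\<in> X)"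
| "substN t x (\<phi> \<^bold>\<longrightarrow> \<psi>) = (substN t x \<phi> \<^bold>\<longrightarrow> substN t x \<psi>)"
| "substN t x (\<^bold>\<forall>y. \<phi>) = (\<^bold>\<forall>y. (if y = x then \<phi> else substN t x \<phi>))"
| "substN t x (\<^bold>\<forall>\<^sub>sY. \<phi>) = (\<^bold>\<forall>\<^sub>sY. substN t x \<phi>)"

primrec substS :: "name \<Rightarrow> name \<Rightarrow> fm \<Rightarrow> fm" where
  "substS Z X \<^bold>\<bottom> = \<^bold>\<bottom>"
| "substS Z X (r \<^bold>= s) = (r \<^bold>= s)"
| "substS Z X (r \<^bold>< s) = (r \<^bold>< s)"
| "substS Z X (r \<^bold>\<in> Y) = (r \<^bold>\<in> (if Y = X then Z else Y))"
| "substS Z X (\<phi> \<^bold>\<longrightarrow> \<psi>) = (substS Z X \<phi> \<^bold>\<longrightarrow> substS Z X \<psi>)"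
| "substS Z X (\<^bold>\<forall>y. \<phi>) = (\<^bold>\<forall>y. substS Z X \<phi>)"
| "substS Z X (\<^bold>\<forall>\<^sub>sY. \<phi>) = (\<^bold>\<forall>\<^sub>sY. (if Y = X then \<phi> else substS Z X \<phi>))"

primrec free_forN :: "tm \<Rightarrow> name \<Rightarrow> fm \<Rightarrow> bool" where
  "free_forN t x \<^bold>\<bottom> = True"
| "free_forN t x (r \<^bold>= s) = True"
| "free_forN t x (r \<^bold>< s) = True"
| "free_forN t x (r \<^bold>\<in> X) = True"
| "free_forN t x (\<phi> \<^bold>\<longrightarrow> \<psi>) = (free_forN t x \<phi> \<and> free_forN t x \<psi>)"
| "free_forN t x (\<^bold>\<forall>y. \<phi>) =
    (x \<notin> fvN (\<^bold>\<forall>y. \<phi>) \<or> (y \<notin> fv_tm t \<and> free_forN t x \<phi>))"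
| "free_forN t x (\<^bold>\<forall>\<^sub>sY. \<phi>) = free_forN t x \<phi>"

primrec free_forS :: "name \<Rightarrow> name \<Rightarrow> fm \<Rightarrow> bool" where
  "free_forS Z X \<^bold>\<bottom> = True"
| "free_forS Z X (r \<^bold>= s) = True"
| "free_forS Z X (r \<^bold>< s) = True"
| "free_forS Z X (r \<^bold>\<in> Y) = True"
| "free_forS Z X (\<phi> \<^bold>\<longrightarrow> \<psi>) = (free_forS Z X \<phi> \<and> free_forS Z X \<psi>)"
| "free_forS Z X (\<^bold>\<forall>y. \<phi>) = free_forS Z X \<phi>"
| "free_forS Z X (\<^bold>\<forall>\<^sub>sY. \<phi>) =
    (X \<notin> fvS (\<^bold>\<forall>\<^sub>sY. \<phi>) \<or> (Y \<noteq> Z \<and> free_forS Z X \<phi>))"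


section \<open>Provability\<close>

text \<open>
  Classical natural deduction for two-sorted predicate logic with equality between numbers.
  \<open>derives T \<Gamma> \<phi>\<close> means that \<open>\<phi>\<close> is derivable from the axioms \<open>T\<close> and the open assumptions
  \<open>\<Gamma>\<close>. The variable conditions of the introduction rules for the quantifiers concern \<open>\<Gamma>\<close> only,
  so a member of \<open>T\<close> with free variables stands for its universal closure.
\<close>

inductive derives :: "fm set \<Rightarrow> fm set \<Rightarrow> fm \<Rightarrow> bool" for T :: "fm set" where
  Axm: "\<phi> \<in> T \<Longrightarrow> derives T \<Gamma> \<phi>"
| Asm: "\<phi> \<in> \<Gamma> \<Longrightarrow> derives T \<Gamma> \<phi>"
| Weak: "derives T \<Gamma> \<phi> \<Longrightarrow> \<Gamma> \<subseteq> \<Delta> \<Longrightarrow> derives T \<Delta> \<phi>"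
| ImpI: "derives T (insert \<phi> \<Gamma>) \<psi> \<Longrightarrow> derives T \<Gamma> (\<phi> \<^bold>\<longrightarrow> \<psi>)"
| ImpE: "derives T \<Gamma> (\<phi> \<^bold>\<longrightarrow> \<psi>) \<Longrightarrow> derives T \<Gamma> \<phi> \<Longrightarrow> derives T \<Gamma> \<psi>"
| RAA: "derives T (insert (\<^bold>\<not> \<phi>) \<Gamma>) \<^bold>\<bottom> \<Longrightarrow> derives T \<Gamma> \<phi>"
| AllNI: "derives T \<Gamma> \<phi> \<Longrightarrow> \<forall>\<gamma>\<in>\<Gamma>. x \<notin> fvN \<gamma> \<Longrightarrow> derives T \<Gamma> (\<^bold>\<forall>x. \<phi>)"
| AllNE: "derives T \<Gamma> (\<^bold>\<forall>x. \<phi>) \<Longrightarrow> free_forN t x \<phi> \<Longrightarrow> derives T \<Gamma> (substN t x \<phi>)"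
| AllSI: "derives T \<Gamma> \<phi> \<Longrightarrow> \<forall>\<gamma>\<in>\<Gamma>. X \<notin> fvS \<gamma> \<Longrightarrow> derives T \<Gamma> (\<^bold>\<forall>\<^sub>sX. \<phi>)"
| AllSE: "derives T \<Gamma> (\<^bold>\<forall>\<^sub>sX. \<phi>) \<Longrightarrow> free_forS Z X \<phi> \<Longrightarrow> derives T \<Gamma> (substS Z X \<phi>)"
| EqI: "derives T \<Gamma> (t \<^bold>= t)"
| EqE: "derives T \<Gamma> (s \<^bold>= t) \<Longrightarrow> derives T \<Gamma> (substN s x \<phi>) \<Longrightarrow>
    free_forN s x \<phi> \<Longrightarrow> free_forN t x \<phi> \<Longrightarrow> derives T \<Gamma> (substN t x \<phi>)"

definition provable :: "fm set \<Rightarrow> fm \<Rightarrow> bool" (infix "\<turnstile>" 50) where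
  "T \<turnstile> \<phi> \<longleftrightarrow> derives T {} \<phi>"


section \<open>The axiom system\<close>

definition basic_axioms :: "fm set" where
  "basic_axioms =
    (let m = Var ''m''; n = Var ''n'' in
     {\<^bold>\<not> n \<^bold>+ One \<^bold>= Zero,
      m \<^bold>+ One \<^bold>= n \<^bold>+ One \<^bold>\<longrightarrow> m \<^bold>= n,
      m \<^bold>+ Zero \<^bold>= m,
      m \<^bold>+ (n \<^bold>+ One) \<^bold>= (m \<^bold>+ n) \<^bold>+ One,
      m \<^bold>\<cdot> Zero \<^bold>= Zero,
      m \<^bold>\<cdot> (n \<^bold>+ One) \<^bold>= m \<^bold>\<cdot> n \<^bold>+ m,
      \<^bold>\<not> m \<^bold>< Zero,
      m \<^bold>< n \<^bold>+ One \<^bold>\<longleftrightarrow> m \<^bold>< n \<^bold>\<or> m \<^bold>= n})"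

definition induction_axiom :: fm where
  "induction_axiom =
    (Zero \<^bold>\<in> ''X'' \<^bold>\<and> (\<^bold>\<forall>''n''. Var ''n'' \<^bold>\<in> ''X'' \<^bold>\<longrightarrow> Var ''n'' \<^bold>+ One \<^bold>\<in> ''X'')
     \<^bold>\<longrightarrow> (\<^bold>\<forall>''n''. Var ''n'' \<^bold>\<in> ''X''))"

primrec arithmetical :: "fm \<Rightarrow> bool" where
  "arithmetical \<^bold>\<bottom> = True"
| "arithmetical (s \<^bold>= t) = True"
| "arithmetical (s \<^bold>< t) = True"
| "arithmetical (t \<^bold>\<in> X) = True"
| "arithmetical (\<phi> \<^bold>\<longrightarrow> \<psi>) = (arithmetical \<phi> \<and> arithmetical \<psi>)"
| "arithmetical (\<^bold>\<forall>x. \<phi>) = arithmetical \<phi>"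
| "arithmetical (\<^bold>\<forall>\<^sub>sX. \<phi>) = False"

definition arithmetical_comprehension :: "fm set" where
  "arithmetical_comprehension =
    {\<^bold>\<exists>\<^sub>sX. \<^bold>\<forall>n. Var n \<^bold>\<in> X \<^bold>\<longleftrightarrow> \<phi> | X n \<phi>. arithmetical \<phi> \<and> X \<notin> fvS \<phi>}"

definition ACA0 :: "fm set" where
  "ACA0 = basic_axioms \<union> {induction_axiom} \<union> arithmetical_comprehension"

definition Sigma12 :: "fm set" where
  "Sigma12 = {\<^bold>\<exists>\<^sub>sX. \<^bold>\<forall>\<^sub>sY. \<theta> | X Y \<theta>. arithmetical \<theta>}"

text \<open>Simpson's pairing \<open>(i + j)\<^sup>2 + i\<close>, which is injective but not onto.\<close>

definition pair :: "tm \<Rightarrow> tm \<Rightarrow> tm" where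
  "pair s t = (s \<^bold>+ t) \<^bold>\<cdot> (s \<^bold>+ t) \<^bold>+ s"

text \<open>
  Dependent choice as in Simpson's book: for \<open>\<eta>(n, X, Y)\<close> in the class,
  \<open>\<forall>n. \<forall>X. \<exists>Y. \<eta>(n, X, Y)\<close> implies \<open>\<exists>Z. \<forall>n. \<eta>(n, (Z)\<^sup>n, (Z)\<^sub>n)\<close>, where
  \<open>(Z)\<^sub>n = {i. (i, n) \<in> Z}\<close> and \<open>(Z)\<^sup>n = {(i, m). (i, m) \<in> Z \<and> m < n}\<close>. These two sets are not
  terms of the language; they are introduced through their defining equivalences. The names
  \<open>k, i, m\<close> are only used as bound variables of those two equivalences.
\<close>

definition dependent_choice :: "fm set \<Rightarrow> fm set" where
  "dependent_choice C =
    {(\<^bold>\<forall>n. \<^bold>\<forall>\<^sub>sX. \<^bold>\<exists>\<^sub>sY. \<eta>) \<^bold>\<longrightarrow>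
       (\<^bold>\<exists>\<^sub>sZ. \<^bold>\<forall>n. \<^bold>\<forall>\<^sub>sX. \<^bold>\<forall>\<^sub>sY.
          (\<^bold>\<forall>k. Var k \<^bold>\<in> X \<^bold>\<longleftrightarrow>
             (\<^bold>\<exists>i. \<^bold>\<exists>m. Var k \<^bold>= pair (Var i) (Var m) \<^bold>\<and>
                Var k \<^bold>\<in> Z \<^bold>\<and> Var m \<^bold>< Var n)) \<^bold>\<and>
          (\<^bold>\<forall>i. Var i \<^bold>\<in> Y \<^bold>\<longleftrightarrow> pair (Var i) (Var n) \<^bold>\<in> Z)
          \<^bold>\<longrightarrow> \<eta>)
     | \<eta> n X Y Z k i m. \<eta> \<in> C \<and> distinct [n, k, i, m] \<and> distinct [X, Y, Z] \<and> Z \<notin> fvS \<eta>}"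

definition Sigma12_DC0 :: "fm set" where
  "Sigma12_DC0 = ACA0 \<union> dependent_choice Sigma12"


section \<open>Coding the formulas of CTL\<close>

text \<open>
  The coding is chosen such that every natural number codes exactly one formula; hence in the
  object language the set of all (codes of) formulas is the set of all numbers. The
  propositional variables are coded by the numbers \<open>5 k + 1\<close>. For binary
  connectives the coding uses Cantor's pairing, which, other than \<open>pair\<close>, is onto;
  \<open>code_Imp\<close> and \<open>code_EU\<close> give its polynomial description.
\<close>

datatype ctl = Prop nat | Bot | CImp ctl ctl | AX ctl | EG ctl | EU ctl ctl

primrec code :: "ctl \<Rightarrow> nat" where
  "code Bot = 0"
| "code (Prop k) = 5 * k + 1"
| "code (CImp a b) = 5 * prod_encode (code a, code b) + 2"
| "code (AX a) = 5 * code a + 3"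
| "code (EG a) = 5 * code a + 4"
| "code (EU a b) = 5 * prod_encode (code a, code b) + 5"

lemma two_prod_encode: "2 * prod_encode (a, b) = (a + b) * (a + b + 1) + 2 * a"
proof -
  have "2 * triangle n = n * (n + 1)" for n
    by (simp add: triangle_def)
  then show ?thesis
    by (simp add: prod_encode_def distrib_left)
qed

lemma code_Imp: "2 * code (CImp a b) =
    5 * ((code a + code b) * (code a + code b + 1) + 2 * code a) + 4"
  using two_prod_encode[of "code a" "code b"] by simp

lemma code_EU: "2 * code (EU a b) =
    5 * ((code a + code b) * (code a + code b + 1) + 2 * code a) + 10"
  using two_prod_encode[of "code a" "code b"] by simp

lemma inj_code: "inj code"
proof (rule injI)
  let ?r = "\<lambda>a. case a of Prop _ \<Rightarrow> 1 :: nat | Bot \<Rightarrow> 0 | CImp _ _ \<Rightarrow> 2 | AX _ \<Rightarrow> 3 | EG _ \<Rightarrow> 4 | EU _ _ \<Rightarrow> 0"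
  have mod5: "code a mod 5 = ?r a" for a
    by (cases a) (simp_all add: mod_Suc)
  have r: "?r a = ?r b" if "code a = code b" for a b
    unfolding mod5[symmetric] that ..
  fix a b
  assume "code a = code b"
  then show "a = b"
  proof (induction a arbitrary: b)
    case (Prop k) then show ?case using r[OF Prop.prems] by (cases b) auto
  next
    case Bot then show ?case using r[OF Bot.prems] by (cases b) auto
  next
    case (CImp a1 a2) then show ?case using r[OF CImp.prems] by (cases b) auto
  next
    case (AX a) then show ?case using r[OF AX.prems] by (cases b) auto
  next
    case (EG a) then show ?case using r[OF EG.prems] by (cases b) auto
  next
    case (EU a1 a2) then show ?case using r[OF EU.prems] by (cases b) auto
  qed
qed

lemma surj_code: "surj code"
proof -
  have "\<exists>a. code a = n" for n
  proof (induction n rule: less_induct)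
    case (less n)
    show ?case
    proof (cases "n = 0")
      case True
      then have "code Bot = n" by simp
      then show ?thesis by blast
    next
      case False
      define q where "q = (n - 1) div 5"
      obtain x y where xy: "prod_decode q = (x, y)" by fastforce
      then have q: "prod_encode (x, y) = q" by (metis prod_decode_inverse)
      have "q < n" using False by (auto simp: q_def)
      moreover have "x \<le> q" "y \<le> q"
        using q le_prod_encode_1 le_prod_encode_2 by metis+
      ultimately obtain a b c where abc: "code a = x" "code b = y" "code c = q"
        using less by (meson le_less_trans)
      have "n = 5 * q + 1 \<or> n = 5 * q + 2 \<or> n = 5 * q + 3 \<or> n = 5 * q + 4 \<or> n = 5 * q + 5"
        using False unfolding q_def by presburger
      moreover have "code (Prop q) = 5 * q + 1" "code (CImp a b) = 5 * q + 2"
        "code (AX c) = 5 * q + 3" "code (EG c) = 5 * q + 4" "code (EU a b) = 5 * q + 5"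
        using abc q by simp_all
      ultimately show ?thesis by metis
    qed
  qed
  then show ?thesis by (metis surjI)
qed

lemma bij_code: "bij code"
  using inj_code surj_code by (rule bijI)


section \<open>The Valuation Extension Lemma as a sentence of second-order arithmetic\<close>

primrec num :: "nat \<Rightarrow> tm" where
  "num 0 = Zero"
| "num (Suc n) = num n \<^bold>+ One"

text \<open>The object-language counterparts of the clauses for \<open>code\<close>.\<close>

definition is_Prop :: "tm \<Rightarrow> fm" where
  "is_Prop c = (\<^bold>\<exists>''k''. c \<^bold>= num 5 \<^bold>\<cdot> Var ''k'' \<^bold>+ num 1)"

definition code_AX :: "tm \<Rightarrow> tm" where
  "code_AX a = num 5 \<^bold>\<cdot> a \<^bold>+ num 3"

definition code_EG :: "tm \<Rightarrow> tm" where
  "code_EG a = num 5 \<^bold>\<cdot> a \<^bold>+ num 4"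

definition is_Imp :: "tm \<Rightarrow> tm \<Rightarrow> tm \<Rightarrow> fm" where
  "is_Imp c a b =
    (num 2 \<^bold>\<cdot> c \<^bold>= num 5 \<^bold>\<cdot> ((a \<^bold>+ b) \<^bold>\<cdot> (a \<^bold>+ b \<^bold>+ num 1) \<^bold>+ num 2 \<^bold>\<cdot> a) \<^bold>+ num 4)"

definition is_EU :: "tm \<Rightarrow> tm \<Rightarrow> tm \<Rightarrow> fm" where
  "is_EU c a b =
    (num 2 \<^bold>\<cdot> c \<^bold>= num 5 \<^bold>\<cdot> ((a \<^bold>+ b) \<^bold>\<cdot> (a \<^bold>+ b \<^bold>+ num 1) \<^bold>+ num 2 \<^bold>\<cdot> a) \<^bold>+ num 10)"

text \<open>
  In the formulas below, the set variables \<open>W\<close>, \<open>R\<close>, \<open>v\<close>, \<open>V\<close>, \<open>f\<close> stand for the objects of the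
  same name, and \<open>a\<close>, \<open>b\<close>, \<open>c\<close> are number variables for codes of formulas. Relations and functions are
  sets of pairs.
\<close>

definition serial_frame :: fm where
  "serial_frame =
    (let w = Var ''w''; u = Var ''u''; p = Var ''p'' in
     (\<^bold>\<exists>''w''. w \<^bold>\<in> ''W'') \<^bold>\<and>
     (\<^bold>\<forall>''p''. p \<^bold>\<in> ''R'' \<^bold>\<longrightarrow>
        (\<^bold>\<exists>''w''. \<^bold>\<exists>''u''. w \<^bold>\<in> ''W'' \<^bold>\<and> u \<^bold>\<in> ''W'' \<^bold>\<and> p \<^bold>= pair w u)) \<^bold>\<and>
     (\<^bold>\<forall>''w''. w \<^bold>\<in> ''W'' \<^bold>\<longrightarrow> (\<^bold>\<exists>''u''. u \<^bold>\<in> ''W'' \<^bold>\<and> pair w u \<^bold>\<in> ''R'')))"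

text \<open>\<open>f\<close> is a path from \<open>w\<close>.\<close>

definition path :: fm where
  "path =
    (let w = Var ''w''; p = Var ''p''; n = Var ''n''; x = Var ''x''; y = Var ''y'' in
     (\<^bold>\<forall>''p''. p \<^bold>\<in> ''f'' \<^bold>\<longrightarrow> (\<^bold>\<exists>''n''. \<^bold>\<exists>''x''. x \<^bold>\<in> ''W'' \<^bold>\<and> p \<^bold>= pair n x)) \<^bold>\<and>
     (\<^bold>\<forall>''n''. \<^bold>\<exists>''x''. pair n x \<^bold>\<in> ''f'') \<^bold>\<and>
     (\<^bold>\<forall>''n''. \<^bold>\<forall>''x''. \<^bold>\<forall>''y''. pair n x \<^bold>\<in> ''f'' \<^bold>\<and> pair n y \<^bold>\<in> ''f'' \<^bold>\<longrightarrow> x \<^bold>= y) \<^bold>\<and>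
     pair Zero w \<^bold>\<in> ''f'' \<^bold>\<and>
     (\<^bold>\<forall>''n''. \<^bold>\<forall>''x''. \<^bold>\<forall>''y''. pair n x \<^bold>\<in> ''f'' \<^bold>\<and> pair (n \<^bold>+ One) y \<^bold>\<in> ''f''
        \<^bold>\<longrightarrow> pair x y \<^bold>\<in> ''R''))"

text \<open>\<open>F\<close> is a function from \<open>W \<times> {a. \<delta>(a)}\<close> to \<open>{0, 1}\<close>, where \<open>\<delta>\<close> may use the number variable \<open>a\<close>.\<close>

definition function01 :: "name \<Rightarrow> fm \<Rightarrow> fm" where
  "function01 F \<delta> =
    (let w = Var ''w''; a = Var ''a''; p = Var ''p''; x = Var ''x''; y = Var ''y'' in
     (\<^bold>\<forall>''p''. p \<^bold>\<in> F \<^bold>\<longrightarrow> (\<^bold>\<exists>''w''. \<^bold>\<exists>''a''. \<^bold>\<exists>''x''.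
        w \<^bold>\<in> ''W'' \<^bold>\<and> \<delta> \<^bold>\<and> (x \<^bold>= Zero \<^bold>\<or> x \<^bold>= One) \<^bold>\<and> p \<^bold>= pair (pair w a) x)) \<^bold>\<and>
     (\<^bold>\<forall>''w''. \<^bold>\<forall>''a''. w \<^bold>\<in> ''W'' \<^bold>\<and> \<delta> \<^bold>\<longrightarrow> (\<^bold>\<exists>''x''. pair (pair w a) x \<^bold>\<in> F)) \<^bold>\<and>
     (\<^bold>\<forall>''w''. \<^bold>\<forall>''a''. \<^bold>\<forall>''x''. \<^bold>\<forall>''y''.
        pair (pair w a) x \<^bold>\<in> F \<^bold>\<and> pair (pair w a) y \<^bold>\<in> F \<^bold>\<longrightarrow> x \<^bold>= y))"

text \<open>\<open>V(s, t) = r\<close>\<close>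

definition val :: "tm \<Rightarrow> tm \<Rightarrow> tm \<Rightarrow> fm" where
  "val s t r = (pair (pair s t) r \<^bold>\<in> ''V'')"

text \<open>
  In the clause for the implication, \<open>y'\<close> is the number \<open>1 - y\<close>, and \<open>z = 1 - x y'\<close> is
  expressed by \<open>z + x y' = 1\<close>.
\<close>

definition ctl_valuation :: fm where
  "ctl_valuation =
    (let w = Var ''w''; u = Var ''u''; a = Var ''a''; b = Var ''b''; c = Var ''c'';
         i = Var ''i''; j = Var ''j''; x = Var ''x''; y = Var ''y''; y' = Var ''y1''; z = Var ''z'' in
     function01 ''V'' (\<^bold>\<not> \<^bold>\<bottom>) \<^bold>\<and>
     (\<^bold>\<forall>''w''. w \<^bold>\<in> ''W'' \<^bold>\<longrightarrow>
        val w Zero Zero \<^bold>\<and>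
        (\<^bold>\<forall>''a''. \<^bold>\<forall>''b''. \<^bold>\<forall>''c''. is_Imp c a b \<^bold>\<longrightarrow>
           (\<^bold>\<forall>''x''. \<^bold>\<forall>''y''. \<^bold>\<forall>''y1''. \<^bold>\<forall>''z''.
              val w a x \<^bold>\<and> val w b y \<^bold>\<and> y' \<^bold>+ y \<^bold>= One \<^bold>\<and> val w c z
              \<^bold>\<longrightarrow> z \<^bold>+ x \<^bold>\<cdot> y' \<^bold>= One)) \<^bold>\<and>
        (\<^bold>\<forall>''a''. val w (code_AX a) One \<^bold>\<longleftrightarrow>
           (\<^bold>\<forall>''u''. u \<^bold>\<in> ''W'' \<^bold>\<longrightarrow> pair w u \<^bold>\<in> ''R'' \<^bold>\<longrightarrow> val u a One)) \<^bold>\<and>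
        (\<^bold>\<forall>''a''. val w (code_EG a) One \<^bold>\<longleftrightarrow>
           (\<^bold>\<exists>\<^sub>s''f''. path \<^bold>\<and>
              (\<^bold>\<forall>''i''. \<^bold>\<forall>''x''. pair i x \<^bold>\<in> ''f'' \<^bold>\<longrightarrow> val x a One))) \<^bold>\<and>
        (\<^bold>\<forall>''a''. \<^bold>\<forall>''b''. \<^bold>\<forall>''c''. is_EU c a b \<^bold>\<longrightarrow>
           (val w c One \<^bold>\<longleftrightarrow>
             (\<^bold>\<exists>\<^sub>s''f''. \<^bold>\<exists>''i''. path \<^bold>\<and>
                (\<^bold>\<forall>''j''. j \<^bold>< i \<^bold>\<longrightarrow>
                   (\<^bold>\<forall>''x''. pair j x \<^bold>\<in> ''f'' \<^bold>\<longrightarrow> val x a One)) \<^bold>\<and>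
                (\<^bold>\<forall>''x''. pair i x \<^bold>\<in> ''f'' \<^bold>\<longrightarrow> val x b One))))))"

definition extends :: fm where
  "extends = (\<^bold>\<forall>''p''. Var ''p'' \<^bold>\<in> ''v'' \<^bold>\<longrightarrow> Var ''p'' \<^bold>\<in> ''V'')"

definition valuation_extension_lemma :: fm where
  "valuation_extension_lemma =
    (\<^bold>\<forall>\<^sub>s''W''. \<^bold>\<forall>\<^sub>s''R''. serial_frame \<^bold>\<longrightarrow>
       (\<^bold>\<forall>\<^sub>s''v''. function01 ''v'' (is_Prop (Var ''a'')) \<^bold>\<longrightarrow>
          (\<^bold>\<exists>\<^sub>s''V''. ctl_valuation \<^bold>\<and> extends)))"

end

theory Submission
  imports Defs "HOL-Library.Countable_Set"
begin

text \<open>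
  By the completeness theorem it suffices to prove the lemma in every, possibly nonstandard,
  model. There, dependent choice yields sets defined by recursion along the number line whose
  \<open>n\<close>-th stage is a \<open>\<Sigma>\<^sup>1\<^sub>1\<close> truth set relative to the earlier stages: the stage is determined
  by "every element has a witness and no other number has one", which is \<open>\<Sigma>\<^sup>1\<^sub>2\<close> after the
  witnesses have been collected. The truth values of the formula with code \<open>n\<close> form such a
  stage, since the codes of the immediate subformulas are smaller than \<open>n\<close> and the clauses for
  \<open>EG\<close> and \<open>EU\<close> ask for a path.
\<close>

section \<open>Semantics\<close>

text \<open>Codes may be nonstandard, so no induction over actual formulas reaches all of them: the
  recursion has to run inside the model. There the obstacle is that a stage asks for the existence
  of a path, and arithmetical comprehension does not supply the set of numbers for which one exists.
  Storing a witness in the stage itself makes "this number has a witness" arithmetical, so that only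
  "no other number has one" keeps a set quantifier, a universal one. That a suitable set exists is
  then a mere case distinction for one number at a time, and choice puts the results together.

  The completeness proof is shaped by the calculus with named variables. Henkin constants are
  themselves names and must never be bound, whereas the axiom schemes have instances with every
  name. Hence models are only required to satisfy the axioms that avoid an infinite stock of names;
  these already prove the lemma.

  Models can be taken on the type \<open>nat\<close>, with arbitrary operations on it: the basic
  axioms keep the numerals apart, so the countable term model is infinite and its elements can be
  renumbered by all natural numbers.\<close>

record 'a interp =
  zero_of :: 'a
  one_of :: 'a
  plus_of :: "'a \<Rightarrow> 'a \<Rightarrow> 'a"
  times_of :: "'a \<Rightarrow> 'a \<Rightarrow> 'a"
  less_of :: "'a \<Rightarrow> 'a \<Rightarrow> bool"
  sets_of :: "'a set set"

primrec tval :: "'a interp \<Rightarrow> (name \<Rightarrow> 'a) \<Rightarrow> tm \<Rightarrow> 'a" where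
  "tval M e (Var x) = e x"
| "tval M e Zero = zero_of M"
| "tval M e One = one_of M"
| "tval M e (s \<^bold>+ t) = plus_of M (tval M e s) (tval M e t)"
| "tval M e (s \<^bold>\<cdot> t) = times_of M (tval M e s) (tval M e t)"

text \<open>Number quantifiers range over a whole type, which is why the term model is later
  renumbered; set quantifiers range over \<open>sets_of M\<close> only, as in Henkin
  semantics.\<close>

primrec sat :: "'a interp \<Rightarrow> (name \<Rightarrow> 'a) \<Rightarrow> (name \<Rightarrow> 'a set) \<Rightarrow> fm \<Rightarrow> bool" where
  "sat M e E \<^bold>\<bottom> = False"
| "sat M e E (s \<^bold>= t) = (tval M e s = tval M e t)"
| "sat M e E (s \<^bold>< t) = less_of M (tval M e s) (tval M e t)"
| "sat M e E (t \<^bold>\<in> X) = (tval M e t \<in> E X)"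
| "sat M e E (\<phi> \<^bold>\<longrightarrow> \<psi>) = (sat M e E \<phi> \<longrightarrow> sat M e E \<psi>)"
| "sat M e E (\<^bold>\<forall>x. \<phi>) = (\<forall>a. sat M (e(x := a)) E \<phi>)"
| "sat M e E (\<^bold>\<forall>\<^sub>sX. \<phi>) = (\<forall>A\<in>sets_of M. sat M e (E(X := A)) \<phi>)"

lemma sat_connectives [simp]:
  "sat M e E (\<^bold>\<not> \<phi>) = (\<not> sat M e E \<phi>)"
  "sat M e E (\<phi> \<^bold>\<or> \<psi>) = (sat M e E \<phi> \<or> sat M e E \<psi>)"
  "sat M e E (\<phi> \<^bold>\<and> \<psi>) = (sat M e E \<phi> \<and> sat M e E \<psi>)"
  "sat M e E (\<phi> \<^bold>\<longleftrightarrow> \<psi>) = (sat M e E \<phi> \<longleftrightarrow> sat M e E \<psi>)"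
  "sat M e E (\<^bold>\<exists>x. \<phi>) = (\<exists>a. sat M (e(x := a)) E \<phi>)"
  "sat M e E (\<^bold>\<exists>\<^sub>sX. \<phi>) = (\<exists>A\<in>sets_of M. sat M e (E(X := A)) \<phi>)"
  by (auto simp: Neg_def Or_def And_def Iff_def ExN_def ExS_def)

text \<open>Both sorts are collected in one set: a name outside it can be substituted for number and
  set variables alike without capture.\<close>

primrec bv :: "fm \<Rightarrow> name set" where
  "bv \<^bold>\<bottom> = {}"
| "bv (s \<^bold>= t) = {}"
| "bv (s \<^bold>< t) = {}"
| "bv (t \<^bold>\<in> X) = {}"
| "bv (\<phi> \<^bold>\<longrightarrow> \<psi>) = bv \<phi> \<union> bv \<psi>"
| "bv (\<^bold>\<forall>x. \<phi>) = insert x (bv \<phi>)"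
| "bv (\<^bold>\<forall>\<^sub>sX. \<phi>) = insert X (bv \<phi>)"

text \<open>Measure for the truth lemma of the term model, where quantifiers lead to substitution
  instances instead of subformulas. Rank 0 characterises the atomic formulas and falsum.\<close>

primrec rank :: "fm \<Rightarrow> nat" where
  "rank \<^bold>\<bottom> = 0"
| "rank (s \<^bold>= t) = 0"
| "rank (s \<^bold>< t) = 0"
| "rank (t \<^bold>\<in> X) = 0"
| "rank (\<phi> \<^bold>\<longrightarrow> \<psi>) = Suc (rank \<phi> + rank \<psi>)"
| "rank (\<^bold>\<forall>x. \<phi>) = Suc (rank \<phi>)"
| "rank (\<^bold>\<forall>\<^sub>sX. \<phi>) = Suc (rank \<phi>)"

lemma finite_fv_tm [simp]: "finite (fv_tm t)"
  by (induction t) auto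

lemma finite_fvN [simp]: "finite (fvN \<phi>)"
  by (induction \<phi>) auto

lemma finite_fvS [simp]: "finite (fvS \<phi>)"
  by (induction \<phi>) auto

lemma finite_bv [simp]: "finite (bv \<phi>)"
  by (induction \<phi>) auto

lemma tval_cong: "(\<And>x. x \<in> fv_tm t \<Longrightarrow> e x = e' x) \<Longrightarrow> tval M e t = tval M e' t"
  by (induction t) auto

lemma sat_cong:
  "(\<And>x. x \<in> fvN \<phi> \<Longrightarrow> e x = e' x) \<Longrightarrow> (\<And>X. X \<in> fvS \<phi> \<Longrightarrow> E X = E' X) \<Longrightarrow>
    sat M e E \<phi> = sat M e' E' \<phi>"
proof (induction \<phi> arbitrary: e e' E E')
  case (Eq s t)
  then show ?case using tval_cong[of s e e' M] tval_cong[of t e e' M] by auto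
next
  case (Less s t)
  then show ?case using tval_cong[of s e e' M] tval_cong[of t e e' M] by auto
next
  case (Mem t X)
  then show ?case using tval_cong[of t e e' M] by auto
next
  case (Imp \<phi> \<psi>)
  from Imp(1)[of e e' E E'] Imp(2)[of e e' E E'] Imp(3,4) show ?case by auto
next
  case (AllN x \<phi>)
  have "sat M (e(x := a)) E \<phi> = sat M (e'(x := a)) E' \<phi>" for a
    using AllN by (intro AllN(1)) auto
  then show ?case by simp
next
  case (AllS X \<phi>)
  have "sat M e (E(X := A)) \<phi> = sat M e' (E'(X := A)) \<phi>" for A
    using AllS by (intro AllS(1)) auto
  then show ?case by simp
qed simp

lemma tval_subst_tm: "tval M e (subst_tm t x s) = tval M (e(x := tval M e t)) s"
  by (induction s) auto

lemma sat_substN: "h \<notin> bv \<phi> \<Longrightarrow> sat M e E (substN (Var h) x \<phi>) = sat M (e(x := e h)) E \<phi>"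
  by (induction \<phi> arbitrary: e E) (auto simp: tval_subst_tm fun_upd_twist)

lemma sat_substS: "Z \<notin> bv \<phi> \<Longrightarrow> sat M e E (substS Z X \<phi>) = sat M e (E(X := E Z)) \<phi>"
  by (induction \<phi> arbitrary: e E) (auto simp: fun_upd_twist)


section \<open>Substitution of fresh names\<close>

lemma subst_tm_id: "x \<notin> fv_tm s \<Longrightarrow> subst_tm t x s = s"
  by (induction s) auto

lemma subst_tm_inverse: "h \<notin> fv_tm s \<Longrightarrow> subst_tm (Var x) h (subst_tm (Var h) x s) = s"
  by (induction s) auto

lemma fv_subst_tm: "fv_tm (subst_tm (Var h) x s) \<subseteq> insert h (fv_tm s - {x})"
  by (induction s) auto

lemma substN_id: "x \<notin> fvN \<phi> \<Longrightarrow> substN t x \<phi> = \<phi>"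
  by (induction \<phi>) (auto simp: subst_tm_id)

lemma substS_id: "X \<notin> fvS \<phi> \<Longrightarrow> substS Z X \<phi> = \<phi>"
  by (induction \<phi>) auto

lemma free_forN_fresh: "fv_tm t \<inter> bv \<phi> = {} \<Longrightarrow> free_forN t x \<phi>"
  by (induction \<phi>) auto

lemma free_forS_fresh: "Z \<notin> bv \<phi> \<Longrightarrow> free_forS Z X \<phi>"
  by (induction \<phi>) auto

lemma free_forN_notin: "x \<notin> fvN \<phi> \<Longrightarrow> free_forN t x \<phi>"
  by (induction \<phi>) auto

lemma free_forS_notin: "X \<notin> fvS \<phi> \<Longrightarrow> free_forS Z X \<phi>"
  by (induction \<phi>) auto

text \<open>Allows a fresh Henkin name to be generalised and then replaced by the original bound
  variable.\<close>

lemma substN_inverse: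
  "h \<notin> fvN \<phi> \<union> bv \<phi> \<Longrightarrow> substN (Var x) h (substN (Var h) x \<phi>) = \<phi>"
  by (induction \<phi>) (auto simp: subst_tm_inverse substN_id)

lemma substS_inverse:
  "Z \<notin> fvS \<phi> \<union> bv \<phi> \<Longrightarrow> substS X Z (substS Z X \<phi>) = \<phi>"
  by (induction \<phi>) (auto simp: substS_id)

lemma fvN_substN: "fvN (substN (Var h) x \<phi>) \<subseteq> insert h (fvN \<phi> - {x})"
  by (induction \<phi>) (auto dest!: subsetD[OF fv_subst_tm])

lemma fvS_substN [simp]: "fvS (substN t x \<phi>) = fvS \<phi>"
  by (induction \<phi>) auto

lemma bv_substN [simp]: "bv (substN t x \<phi>) = bv \<phi>"
  by (induction \<phi>) auto

lemma rank_substN [simp]: "rank (substN t x \<phi>) = rank \<phi>"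
  by (induction \<phi>) auto

lemma fvS_substS: "fvS (substS Z X \<phi>) \<subseteq> insert Z (fvS \<phi> - {X})"
  by (induction \<phi>) auto

lemma fvN_substS [simp]: "fvN (substS Z X \<phi>) = fvN \<phi>"
  by (induction \<phi>) auto

lemma bv_substS [simp]: "bv (substS Z X \<phi>) = bv \<phi>"
  by (induction \<phi>) auto

lemma rank_substS [simp]: "rank (substS Z X \<phi>) = rank \<phi>"
  by (induction \<phi>) auto

lemma free_forN_inverse:
  "h \<notin> fvN \<phi> \<union> bv \<phi> \<Longrightarrow> free_forN (Var x) h (substN (Var h) x \<phi>)"
  by (induction \<phi>) (auto intro: free_forN_notin)

lemma free_forS_inverse:
  "Z \<notin> fvS \<phi> \<union> bv \<phi> \<Longrightarrow> free_forS X Z (substS Z X \<phi>)"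
  by (induction \<phi>) (auto intro: free_forS_notin)


section \<open>Derived rules\<close>

text \<open>Needed to return from the axioms that avoid the Henkin names to the full system.\<close>

lemma derives_mono:
  assumes "derives T \<Gamma> \<phi>" "T \<subseteq> U" shows "derives U \<Gamma> \<phi>"
  using assms(1)
proof (induction rule: derives.induct)
  case (Axm \<phi> \<Gamma>) then show ?case using assms(2) by (blast intro: derives.Axm)
next
  case (Asm \<phi> \<Gamma>) then show ?case by (rule derives.Asm)
next
  case (Weak \<Gamma> \<phi> \<Delta>) then show ?case by (blast intro: derives.Weak)
next
  case (ImpI \<phi> \<Gamma> \<psi>) show ?case by (rule derives.ImpI) fact
next
  case (ImpE \<Gamma> \<phi> \<psi>) show ?case by (rule derives.ImpE) fact+
next
  case (RAA \<phi> \<Gamma>) show ?case by (rule derives.RAA) fact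
next
  case (AllNI \<Gamma> \<phi> x) show ?case by (rule derives.AllNI) fact+
next
  case (AllNE \<Gamma> x \<phi> t) show ?case by (rule derives.AllNE) fact+
next
  case (AllSI \<Gamma> \<phi> X) show ?case by (rule derives.AllSI) fact+
next
  case (AllSE \<Gamma> X \<phi> Z) show ?case by (rule derives.AllSE) fact+
next
  case (EqI \<Gamma> t) show ?case by (rule derives.EqI)
next
  case (EqE \<Gamma> s t x \<phi>) show ?case by (rule derives.EqE) fact+
qed

lemma derives_cut: "derives T \<Gamma> \<phi> \<Longrightarrow> derives T (insert \<phi> \<Gamma>) \<psi> \<Longrightarrow> derives T \<Gamma> \<psi>"
  by (rule ImpE[OF ImpI])

lemma derives_Fls: "derives T \<Gamma> \<^bold>\<bottom> \<Longrightarrow> derives T \<Gamma> \<phi>"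
  by (rule RAA, erule Weak) blast

lemma derives_NegI: "derives T (insert \<phi> \<Gamma>) \<^bold>\<bottom> \<Longrightarrow> derives T \<Gamma> (\<^bold>\<not> \<phi>)"
  unfolding Neg_def by (rule ImpI)

lemma derives_NegE: "derives T \<Gamma> (\<^bold>\<not> \<phi>) \<Longrightarrow> derives T \<Gamma> \<phi> \<Longrightarrow> derives T \<Gamma> \<^bold>\<bottom>"
  unfolding Neg_def by (rule ImpE)

lemma ex_name_notin:
  assumes "finite A" obtains x :: name where "x \<notin> A"
  using assms ex_new_if_finite infinite_UNIV_listI by blast

text \<open>Rank 0 excludes quantifiers, so both side conditions of \<open>EqE\<close> against
  capture hold automatically.\<close>

lemma derives_Eq_subst:
  assumes "derives T \<Gamma> (s \<^bold>= t)" "derives T \<Gamma> (substN s x \<phi>)" "rank \<phi> = 0"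
  shows "derives T \<Gamma> (substN t x \<phi>)"
proof -
  have "free_forN r x \<phi>" for r
    using assms(3) by (cases \<phi>) auto
  then show ?thesis using EqE[OF assms(1,2)] by simp
qed

lemma derives_sym:
  assumes "derives T \<Gamma> (s \<^bold>= t)" shows "derives T \<Gamma> (t \<^bold>= s)"
proof -
  obtain x where "x \<notin> fv_tm s" using ex_name_notin finite_fv_tm by blast
  then show ?thesis
    using derives_Eq_subst[OF assms, of x "Var x \<^bold>= s"] by (simp add: subst_tm_id EqI)
qed

lemma derives_trans:
  assumes "derives T \<Gamma> (s \<^bold>= t)" "derives T \<Gamma> (t \<^bold>= r)" shows "derives T \<Gamma> (s \<^bold>= r)"
proof -
  obtain x where "x \<notin> fv_tm s" using ex_name_notin finite_fv_tm by blast
  then show ?thesis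
    using derives_Eq_subst[OF assms(2), of x "s \<^bold>= Var x"] assms(1) by (simp add: subst_tm_id)
qed

lemma
  assumes "derives T \<Gamma> (s \<^bold>= s')" "derives T \<Gamma> (t \<^bold>= t')"
  shows derives_cong_Plus: "derives T \<Gamma> (s \<^bold>+ t \<^bold>= s' \<^bold>+ t')"
    and derives_cong_Times: "derives T \<Gamma> (s \<^bold>\<cdot> t \<^bold>= s' \<^bold>\<cdot> t')"
    and derives_cong_Less: "derives T \<Gamma> (s \<^bold>< t) \<Longrightarrow> derives T \<Gamma> (s' \<^bold>< t')"
    and derives_cong_Mem: "derives T \<Gamma> (s \<^bold>\<in> X) \<Longrightarrow> derives T \<Gamma> (s' \<^bold>\<in> X)"
proof -
  have "finite (fv_tm s \<union> fv_tm t \<union> fv_tm s' \<union> fv_tm t')" by simp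
  \<comment> \<open>The fresh \<open>x\<close> marks the single occurrence to be rewritten; Leibniz
    replacement then changes one argument at a time.\<close>
  then obtain x where x: "x \<notin> fv_tm s \<union> fv_tm t \<union> fv_tm s' \<union> fv_tm t'"
    by (rule ex_name_notin)
  have "derives T \<Gamma> (s \<^bold>+ t \<^bold>= s' \<^bold>+ t)" "derives T \<Gamma> (s \<^bold>\<cdot> t \<^bold>= s' \<^bold>\<cdot> t)"
    using derives_Eq_subst[OF assms(1), of x "s \<^bold>+ t \<^bold>= Var x \<^bold>+ t"]
      derives_Eq_subst[OF assms(1), of x "s \<^bold>\<cdot> t \<^bold>= Var x \<^bold>\<cdot> t"] x
    by (simp_all add: subst_tm_id EqI)
  then show "derives T \<Gamma> (s \<^bold>+ t \<^bold>= s' \<^bold>+ t')" "derives T \<Gamma> (s \<^bold>\<cdot> t \<^bold>= s' \<^bold>\<cdot> t')"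
    using derives_Eq_subst[OF assms(2), of x "s \<^bold>+ t \<^bold>= s' \<^bold>+ Var x"]
      derives_Eq_subst[OF assms(2), of x "s \<^bold>\<cdot> t \<^bold>= s' \<^bold>\<cdot> Var x"] x
    by (simp_all add: subst_tm_id)
  show "derives T \<Gamma> (s' \<^bold>\<in> X)" if "derives T \<Gamma> (s \<^bold>\<in> X)"
    using derives_Eq_subst[OF assms(1), of x "Var x \<^bold>\<in> X"] x that by (simp add: subst_tm_id)
  show "derives T \<Gamma> (s' \<^bold>< t')" if "derives T \<Gamma> (s \<^bold>< t)"
  proof -
    have "derives T \<Gamma> (s' \<^bold>< t)"
      using derives_Eq_subst[OF assms(1), of x "Var x \<^bold>< t"] x that by (simp add: subst_tm_id)
    then show ?thesis
      using derives_Eq_subst[OF assms(2), of x "s' \<^bold>< Var x"] x by (simp add: subst_tm_id)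
  qed
qed

section \<open>Completeness\<close>

text \<open>
  The names in \<open>H\<close> play the role of the Henkin constants. Since they are never bound in the
  formulas under consideration, substituting them cannot cause capture, and no renaming of
  bound variables is needed.
\<close>

definition sentence_over :: "name set \<Rightarrow> fm \<Rightarrow> bool" where
  "sentence_over H \<phi> \<longleftrightarrow> bv \<phi> \<inter> H = {} \<and> fvN \<phi> \<subseteq> H \<and> fvS \<phi> \<subseteq> H"

lemma sentence_over_simps [simp]:
  "sentence_over H \<^bold>\<bottom>"
  "sentence_over H (s \<^bold>= t) \<longleftrightarrow> fv_tm s \<subseteq> H \<and> fv_tm t \<subseteq> H"
  "sentence_over H (s \<^bold>< t) \<longleftrightarrow> fv_tm s \<subseteq> H \<and> fv_tm t \<subseteq> H"
  "sentence_over H (t \<^bold>\<in> X) \<longleftrightarrow> fv_tm t \<subseteq> H \<and> X \<in> H"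
  "sentence_over H (\<phi> \<^bold>\<longrightarrow> \<psi>) \<longleftrightarrow> sentence_over H \<phi> \<and> sentence_over H \<psi>"
  "sentence_over H (\<^bold>\<not> \<phi>) \<longleftrightarrow> sentence_over H \<phi>"
  by (auto simp: sentence_over_def Neg_def)

lemma sentence_over_substN:
  "sentence_over H (\<^bold>\<forall>x. \<phi>) \<Longrightarrow> h \<in> H \<Longrightarrow> sentence_over H (substN (Var h) x \<phi>)"
  using fvN_substN[of h x \<phi>] by (auto simp: sentence_over_def)

lemma sentence_over_substS:
  "sentence_over H (\<^bold>\<forall>\<^sub>sX. \<phi>) \<Longrightarrow> Z \<in> H \<Longrightarrow> sentence_over H (substS Z X \<phi>)"
  using fvS_substS[of Z X \<phi>] by (auto simp: sentence_over_def)

text \<open>If the negated instance were inconsistent with the context, the instance at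
  \<open>h\<close> would be derivable from it. As \<open>h\<close> is fresh, it can be generalised,
  which contradicts the negated universal formula.\<close>

lemma henkin_witnessN:
  assumes con: "\<not> derives T (insert (\<^bold>\<not> (\<^bold>\<forall>x. \<phi>)) \<Gamma>) \<^bold>\<bottom>"
    and h: "h \<notin> fvN \<phi> \<union> bv \<phi>" "h \<noteq> x" "\<forall>\<gamma>\<in>\<Gamma>. h \<notin> fvN \<gamma> \<and> x \<notin> fvN \<gamma>"
  shows "\<not> derives T (insert (\<^bold>\<not> substN (Var h) x \<phi>) (insert (\<^bold>\<not> (\<^bold>\<forall>x. \<phi>)) \<Gamma>)) \<^bold>\<bottom>"
proof
  let ?\<Delta> = "insert (\<^bold>\<not> (\<^bold>\<forall>x. \<phi>)) \<Gamma>"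
  assume "derives T (insert (\<^bold>\<not> substN (Var h) x \<phi>) ?\<Delta>) \<^bold>\<bottom>"
  then have "derives T ?\<Delta> (substN (Var h) x \<phi>)" by (rule RAA)
  then have "derives T ?\<Delta> (\<^bold>\<forall>h. substN (Var h) x \<phi>)"
    by (rule AllNI) (use h in \<open>auto simp: Neg_def\<close>)
  then have "derives T ?\<Delta> \<phi>"
    using AllNE[of T ?\<Delta> h "substN (Var h) x \<phi>" "Var x"] free_forN_inverse substN_inverse h(1)
    by auto
  \<comment> \<open>Generalising over the original \<open>x\<close> again needs \<open>x\<close> to
    be absent from the context: bound names lie outside \<open>H\<close>, free ones inside.\<close>
  then have "derives T ?\<Delta> (\<^bold>\<forall>x. \<phi>)"
    by (rule AllNI) (use h in \<open>auto simp: Neg_def\<close>)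
  moreover have "derives T ?\<Delta> (\<^bold>\<not> (\<^bold>\<forall>x. \<phi>))" by (simp add: Asm)
  ultimately show False using con derives_NegE by blast
qed

lemma henkin_witnessS:
  assumes con: "\<not> derives T (insert (\<^bold>\<not> (\<^bold>\<forall>\<^sub>sX. \<phi>)) \<Gamma>) \<^bold>\<bottom>"
    and Z: "Z \<notin> fvS \<phi> \<union> bv \<phi>" "Z \<noteq> X" "\<forall>\<gamma>\<in>\<Gamma>. Z \<notin> fvS \<gamma> \<and> X \<notin> fvS \<gamma>"
  shows "\<not> derives T (insert (\<^bold>\<not> substS Z X \<phi>) (insert (\<^bold>\<not> (\<^bold>\<forall>\<^sub>sX. \<phi>)) \<Gamma>)) \<^bold>\<bottom>"
proof
  let ?\<Delta> = "insert (\<^bold>\<not> (\<^bold>\<forall>\<^sub>sX. \<phi>)) \<Gamma>"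
  assume "derives T (insert (\<^bold>\<not> substS Z X \<phi>) ?\<Delta>) \<^bold>\<bottom>"
  then have "derives T ?\<Delta> (substS Z X \<phi>)" by (rule RAA)
  then have "derives T ?\<Delta> (\<^bold>\<forall>\<^sub>sZ. substS Z X \<phi>)"
    by (rule AllSI) (use Z in \<open>auto simp: Neg_def\<close>)
  then have "derives T ?\<Delta> \<phi>"
    using AllSE[of T ?\<Delta> Z "substS Z X \<phi>" X] free_forS_inverse substS_inverse Z(1)
    by auto
  then have "derives T ?\<Delta> (\<^bold>\<forall>\<^sub>sX. \<phi>)"
    by (rule AllSI) (use Z in \<open>auto simp: Neg_def\<close>)
  moreover have "derives T ?\<Delta> (\<^bold>\<not> (\<^bold>\<forall>\<^sub>sX. \<phi>))" by (simp add: Asm)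
  ultimately show False using con derives_NegE by blast
qed

lemma ex_in_infinite:
  assumes "infinite H" "finite A" obtains h where "h \<in> H" "h \<notin> A"
  using assms by (meson finite_subset subsetI)

text \<open>The target of one stage of the Lindenbaum construction. A rejected formula is merely
  refuted; its negation enters the union later by deductive closure.\<close>

definition settles :: "fm set \<Rightarrow> name set \<Rightarrow> fm \<Rightarrow> fm set \<Rightarrow> bool" where
  "settles T H \<phi> \<Gamma> \<longleftrightarrow>
    (\<phi> \<in> \<Gamma> \<or> derives T (insert \<phi> \<Gamma>) \<^bold>\<bottom>) \<and>
    (\<forall>x \<psi>. \<phi> \<in> \<Gamma> \<longrightarrow> \<phi> = (\<^bold>\<not> (\<^bold>\<forall>x. \<psi>)) \<longrightarrow> (\<exists>h\<in>H. (\<^bold>\<not> substN (Var h) x \<psi>) \<in> \<Gamma>)) \<and>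
    (\<forall>X \<psi>. \<phi> \<in> \<Gamma> \<longrightarrow> \<phi> = (\<^bold>\<not> (\<^bold>\<forall>\<^sub>sX. \<psi>)) \<longrightarrow> (\<exists>Z\<in>H. (\<^bold>\<not> substS Z X \<psi>) \<in> \<Gamma>))"

lemma henkin_step:
  assumes H: "infinite H" and \<Gamma>: "finite \<Gamma>" "\<And>\<gamma>. \<gamma> \<in> \<Gamma> \<Longrightarrow> sentence_over H \<gamma>"
    and con: "\<not> derives T \<Gamma> \<^bold>\<bottom>" and \<phi>: "sentence_over H \<phi>"
  shows "\<exists>\<Delta>. finite \<Delta> \<and> (\<forall>\<gamma>\<in>\<Delta>. sentence_over H \<gamma>) \<and> \<not> derives T \<Delta> \<^bold>\<bottom> \<and> \<Gamma> \<subseteq> \<Delta> \<and>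
    settles T H \<phi> \<Delta>"
proof (cases "derives T (insert \<phi> \<Gamma>) \<^bold>\<bottom>")
  case True
  then have "\<phi> \<notin> \<Gamma>" using con by (metis insert_absorb)
  then show ?thesis using \<Gamma> con True by (intro exI[of _ \<Gamma>]) (simp add: settles_def)
next
  case False
  have "finite (bv \<phi> \<union> (\<Union>\<gamma>\<in>insert \<phi> \<Gamma>. fvN \<gamma> \<union> fvS \<gamma>))" using \<Gamma>(1) by auto
  then obtain h where h: "h \<in> H" "h \<notin> bv \<phi> \<union> (\<Union>\<gamma>\<in>insert \<phi> \<Gamma>. fvN \<gamma> \<union> fvS \<gamma>)"
    by (rule ex_in_infinite[OF H])
  consider (N) x \<psi> where "\<phi> = (\<^bold>\<not> (\<^bold>\<forall>x. \<psi>))" | (S) X \<psi> where "\<phi> = (\<^bold>\<not> (\<^bold>\<forall>\<^sub>sX. \<psi>))"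
    | (no) "\<And>x \<psi>. \<phi> \<noteq> (\<^bold>\<not> (\<^bold>\<forall>x. \<psi>))" "\<And>X \<psi>. \<phi> \<noteq> (\<^bold>\<not> (\<^bold>\<forall>\<^sub>sX. \<psi>))"
    by blast
  then show ?thesis
  proof cases
    case N
    have *: "x \<notin> H" "sentence_over H (\<^bold>\<forall>x. \<psi>)" using \<phi> by (auto simp: N sentence_over_def Neg_def)
    have "\<not> derives T (insert (\<^bold>\<not> substN (Var h) x \<psi>) (insert \<phi> \<Gamma>)) \<^bold>\<bottom>"
      unfolding N
    proof (rule henkin_witnessN)
      show "\<forall>\<gamma>\<in>\<Gamma>. h \<notin> fvN \<gamma> \<and> x \<notin> fvN \<gamma>"
        using h \<Gamma>(2) * by (auto simp: sentence_over_def)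
    qed (use False N h * in \<open>auto simp: Neg_def\<close>)
    then show ?thesis
      using \<Gamma> \<phi> h(1) sentence_over_substN[OF *(2) h(1)]
      by (intro exI[of _ "insert (\<^bold>\<not> substN (Var h) x \<psi>) (insert \<phi> \<Gamma>)"])
        (auto simp: N Neg_def settles_def)
  next
    case S
    have *: "X \<notin> H" "sentence_over H (\<^bold>\<forall>\<^sub>sX. \<psi>)" using \<phi> by (auto simp: S sentence_over_def Neg_def)
    have "\<not> derives T (insert (\<^bold>\<not> substS h X \<psi>) (insert \<phi> \<Gamma>)) \<^bold>\<bottom>"
      unfolding S
    proof (rule henkin_witnessS)
      show "\<forall>\<gamma>\<in>\<Gamma>. h \<notin> fvS \<gamma> \<and> X \<notin> fvS \<gamma>"
        using h \<Gamma>(2) * by (auto simp: sentence_over_def)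
    qed (use False S h * in \<open>auto simp: Neg_def\<close>)
    then show ?thesis
      using \<Gamma> \<phi> h(1) sentence_over_substS[OF *(2) h(1)]
      by (intro exI[of _ "insert (\<^bold>\<not> substS h X \<psi>) (insert \<phi> \<Gamma>)"])
        (auto simp: S Neg_def settles_def)
  next
    case no
    then show ?thesis
      using False \<Gamma> \<phi> by (intro exI[of _ "insert \<phi> \<Gamma>"]) (auto simp: settles_def)
  qed
qed

instance tm :: countable by countable_datatype
instance fm :: countable by countable_datatype

text \<open>Deductive closure speaks of finite assumption sets because each of these lies within a
  single stage of the chain whose union is \<open>\<Delta>\<close>.\<close>

locale henkin_set =
  fixes T :: "fm set" and H :: "name set" and \<Delta> :: "fm set"
  assumes inf_compl: "infinite (- H)"
    and sentences: "\<phi> \<in> \<Delta> \<Longrightarrow> sentence_over H \<phi>"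
    and closed: "finite \<Gamma> \<Longrightarrow> \<Gamma> \<subseteq> \<Delta> \<Longrightarrow> derives T \<Gamma> \<phi> \<Longrightarrow> sentence_over H \<phi> \<Longrightarrow> \<phi> \<in> \<Delta>"
    and consistent: "\<^bold>\<bottom> \<notin> \<Delta>"
    and maximal: "sentence_over H \<phi> \<Longrightarrow> \<phi> \<in> \<Delta> \<or> (\<^bold>\<not> \<phi>) \<in> \<Delta>"
    and witnessN: "(\<^bold>\<not> (\<^bold>\<forall>x. \<phi>)) \<in> \<Delta> \<Longrightarrow> \<exists>h\<in>H. (\<^bold>\<not> substN (Var h) x \<phi>) \<in> \<Delta>"
    and witnessS: "(\<^bold>\<not> (\<^bold>\<forall>\<^sub>sX. \<phi>)) \<in> \<Delta> \<Longrightarrow> \<exists>Z\<in>H. (\<^bold>\<not> substS Z X \<phi>) \<in> \<Delta>"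

lemma ex_henkin_set:
  assumes H: "infinite H" "infinite (- H)" and \<phi>: "sentence_over H \<phi>" and "\<not> derives T {} \<phi>"
  obtains \<Delta> where "henkin_set T H \<Delta>" "(\<^bold>\<not> \<phi>) \<in> \<Delta>"
proof -
  define P where "P \<Gamma> \<longleftrightarrow> finite \<Gamma> \<and> (\<forall>\<gamma>\<in>\<Gamma>. sentence_over H \<gamma>) \<and> \<not> derives T \<Gamma> \<^bold>\<bottom> \<and> (\<^bold>\<not> \<phi>) \<in> \<Gamma>" for \<Gamma>
  \<comment> \<open>The formula with number \<open>n\<close> is treated in the step from
    \<open>G n\<close> to \<open>G (Suc n)\<close>.\<close>
  define Q where "Q n \<Gamma> \<Gamma>' \<longleftrightarrow> \<Gamma> \<subseteq> \<Gamma>' \<and>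
      (sentence_over H (from_nat n) \<longrightarrow> settles T H (from_nat n) \<Gamma>')" for n :: nat and \<Gamma> \<Gamma>'
  have "P {\<^bold>\<not> \<phi>}" 
    unfolding P_def using assms(4) RAA[of T \<phi> "{}"] \<phi> by (simp del: insert_iff) auto
  moreover have "\<exists>\<Gamma>'. P \<Gamma>' \<and> Q n \<Gamma> \<Gamma>'" if "P \<Gamma>" for n \<Gamma>
  proof (cases "sentence_over H (from_nat n)")
    case True
    then show ?thesis
      using henkin_step[OF H(1), of \<Gamma> T "from_nat n"] that unfolding P_def Q_def by blast
  next
    case False
    then have "Q n \<Gamma> \<Gamma>" unfolding Q_def by auto
    then show ?thesis using that by blast
  qed
  ultimately obtain G where G: "\<And>n. P (G n)" "\<And>n. Q n (G n) (G (Suc n))"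
    using dependent_nat_choice[of "\<lambda>_. P" Q] by metis
  have mono: "G m \<subseteq> G n" if "m \<le> n" for m n
    using lift_Suc_mono_le[of G m n] G(2) that unfolding Q_def by blast
  define \<Delta> where "\<Delta> = (\<Union>n. G n)"
  have fin: "\<exists>n. \<Gamma> \<subseteq> G n" if "finite \<Gamma>" "\<Gamma> \<subseteq> \<Delta>" for \<Gamma>
    using that
  proof (induction \<Gamma>)
    case (insert \<gamma> \<Gamma>)
    then obtain m n where "\<gamma> \<in> G m" "\<Gamma> \<subseteq> G n" by (auto simp: \<Delta>_def)
    then have "insert \<gamma> \<Gamma> \<subseteq> G (max m n)" using mono[of m "max m n"] mono[of n "max m n"] by auto
    then show ?case by blast
  qed simp
  have decided: "\<psi> \<in> \<Delta> \<or> (\<exists>n. derives T (insert \<psi> (G n)) \<^bold>\<bottom>)" if "sentence_over H \<psi>" for \<psi>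
    using G(2)[of "to_nat \<psi>"] that unfolding Q_def settles_def
    by (auto simp: \<Delta>_def)
  have closed: "\<psi> \<in> \<Delta>" if a: "finite \<Gamma>" "\<Gamma> \<subseteq> \<Delta>" "derives T \<Gamma> \<psi>" "sentence_over H \<psi>" for \<Gamma> \<psi>
  proof (rule ccontr)
    assume "\<psi> \<notin> \<Delta>"
    then obtain n where n: "derives T (insert \<psi> (G n)) \<^bold>\<bottom>" using decided a(4) by blast
    obtain m where m: "\<Gamma> \<subseteq> G m" using fin a by blast
    have "G n \<subseteq> G (max m n)" "G m \<subseteq> G (max m n)" using mono by auto
    then have "derives T (G (max m n)) \<psi>" "derives T (insert \<psi> (G (max m n))) \<^bold>\<bottom>"
      using n m a(3) by (auto elim!: Weak)
    then have "derives T (G (max m n)) \<^bold>\<bottom>" by (rule derives_cut)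
    then show False using G(1) by (auto simp: P_def)
  qed
  \<comment> \<open>A member of the union cannot have been refuted at its own stage, since some
    later consistent stage contains it. So it was accepted there and received its witness
    there.\<close>
  have wit: "\<psi> \<in> G (Suc (to_nat \<psi>)) \<and> settles T H \<psi> (G (Suc (to_nat \<psi>)))" if \<psi>: "\<psi> \<in> \<Delta>" for \<psi>
  proof -
    obtain n where n: "\<psi> \<in> G n" using \<psi> by (auto simp: \<Delta>_def)
    have "sentence_over H \<psi>" using G(1) n by (auto simp: P_def)
    then have *: "settles T H \<psi> (G (Suc (to_nat \<psi>)))"
      using G(2)[of "to_nat \<psi>"] unfolding Q_def by simp
    moreover have "\<not> derives T (insert \<psi> (G (Suc (to_nat \<psi>)))) \<^bold>\<bottom>"
    proof
      let ?k = "max n (Suc (to_nat \<psi>))"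
      assume "derives T (insert \<psi> (G (Suc (to_nat \<psi>)))) \<^bold>\<bottom>"
      moreover have "insert \<psi> (G (Suc (to_nat \<psi>))) \<subseteq> G ?k"
        using mono[of n ?k] mono[of "Suc (to_nat \<psi>)" ?k] n by auto
      ultimately have "derives T (G ?k) \<^bold>\<bottom>" by (rule Weak)
      then show False using G(1) by (auto simp: P_def)
    qed
    ultimately show ?thesis unfolding settles_def by blast
  qed
  have "henkin_set T H \<Delta>"
  proof
    show "infinite (- H)" by fact
    show sent: "sentence_over H \<psi>" if "\<psi> \<in> \<Delta>" for \<psi>
      using that G(1) by (auto simp: P_def \<Delta>_def)
    show "\<psi> \<in> \<Delta>" if "finite \<Gamma>" "\<Gamma> \<subseteq> \<Delta>" "derives T \<Gamma> \<psi>" "sentence_over H \<psi>" for \<Gamma> \<psi>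
      using closed that by blast
    show "\<^bold>\<bottom> \<notin> \<Delta>" using G(1) Asm by (fastforce simp: P_def \<Delta>_def)
    show "\<psi> \<in> \<Delta> \<or> (\<^bold>\<not> \<psi>) \<in> \<Delta>" if s: "sentence_over H \<psi>" for \<psi>
    proof -
      have "(\<^bold>\<not> \<psi>) \<in> \<Delta>" if "derives T (insert \<psi> (G n)) \<^bold>\<bottom>" for n
        using closed[of "G n" "\<^bold>\<not> \<psi>"] derives_NegI[OF that] G(1)[of n] s
        by (auto simp: P_def \<Delta>_def)
      then show ?thesis using decided[OF s] by blast
    qed
    show "\<exists>h\<in>H. (\<^bold>\<not> substN (Var h) x \<psi>) \<in> \<Delta>" if "(\<^bold>\<not> (\<^bold>\<forall>x. \<psi>)) \<in> \<Delta>" for x \<psi>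
      using wit[OF that] unfolding settles_def \<Delta>_def by blast
    show "\<exists>Z\<in>H. (\<^bold>\<not> substS Z X \<psi>) \<in> \<Delta>" if "(\<^bold>\<not> (\<^bold>\<forall>\<^sub>sX. \<psi>)) \<in> \<Delta>" for X \<psi>
      using wit[OF that] unfolding settles_def \<Delta>_def by blast
  qed
  moreover have "(\<^bold>\<not> \<phi>) \<in> \<Delta>" using G(1)[of 0] by (auto simp: P_def \<Delta>_def)
  ultimately show thesis using that by blast
qed

context henkin_set
begin

section \<open>The term model of a Henkin set\<close>

definition terms :: "tm set" where
  "terms = {t. fv_tm t \<subseteq> H}"

lemma terms_simps [simp]:
  "Var x \<in> terms \<longleftrightarrow> x \<in> H" "Zero \<in> terms" "One \<in> terms"
  "s \<^bold>+ t \<in> terms \<longleftrightarrow> s \<in> terms \<and> t \<in> terms"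
  "s \<^bold>\<cdot> t \<in> terms \<longleftrightarrow> s \<in> terms \<and> t \<in> terms"
  by (auto simp: terms_def)

lemma num_in_terms [simp]: "num n \<in> terms"
  by (induction n) auto

lemma refl_in: "t \<in> terms \<Longrightarrow> (t \<^bold>= t) \<in> \<Delta>"
  using closed[of "{}" "t \<^bold>= t"] EqI by (auto simp: terms_def)

lemma sym_in: "(s \<^bold>= t) \<in> \<Delta> \<Longrightarrow> (t \<^bold>= s) \<in> \<Delta>"
  using closed[of "{s \<^bold>= t}" "t \<^bold>= s", OF _ _ derives_sym] sentences[of "s \<^bold>= t"]
  by (auto intro: Asm)

lemma trans_in: "(s \<^bold>= t) \<in> \<Delta> \<Longrightarrow> (t \<^bold>= r) \<in> \<Delta> \<Longrightarrow> (s \<^bold>= r) \<in> \<Delta>"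
  using closed[of "{s \<^bold>= t, t \<^bold>= r}" "s \<^bold>= r", OF _ _ derives_trans[of _ _ _ t]]
    sentences[of "s \<^bold>= t"] sentences[of "t \<^bold>= r"]
  by (auto intro: Asm)

lemma cong_in:
  assumes "(s \<^bold>= s') \<in> \<Delta>" "(t \<^bold>= t') \<in> \<Delta>"
  shows "(s \<^bold>+ t \<^bold>= s' \<^bold>+ t') \<in> \<Delta>" "(s \<^bold>\<cdot> t \<^bold>= s' \<^bold>\<cdot> t') \<in> \<Delta>"
    and "(s \<^bold>< t) \<in> \<Delta> \<Longrightarrow> (s' \<^bold>< t') \<in> \<Delta>"
    and "(s \<^bold>\<in> X) \<in> \<Delta> \<Longrightarrow> (s' \<^bold>\<in> X) \<in> \<Delta>"
proof -
  note sent = sentences[OF assms(1)] sentences[OF assms(2)]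
  show "(s \<^bold>+ t \<^bold>= s' \<^bold>+ t') \<in> \<Delta>"
    by (rule closed[of "{s \<^bold>= s', t \<^bold>= t'}", OF _ _ derives_cong_Plus])
      (use assms sent in \<open>auto intro: Asm\<close>)
  show "(s \<^bold>\<cdot> t \<^bold>= s' \<^bold>\<cdot> t') \<in> \<Delta>"
    by (rule closed[of "{s \<^bold>= s', t \<^bold>= t'}", OF _ _ derives_cong_Times])
      (use assms sent in \<open>auto intro: Asm\<close>)
  show "(s' \<^bold>< t') \<in> \<Delta>" if "(s \<^bold>< t) \<in> \<Delta>"
    by (rule closed[of "{s \<^bold>= s', t \<^bold>= t', s \<^bold>< t}", OF _ _ derives_cong_Less[of _ _ s _ t]])
      (use assms sent that in \<open>auto intro: Asm\<close>)
  show "(s' \<^bold>\<in> X) \<in> \<Delta>" if "(s \<^bold>\<in> X) \<in> \<Delta>"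
    by (rule closed[of "{s \<^bold>= s', s \<^bold>\<in> X}", OF _ _ derives_cong_Mem[of _ _ s _ s s]])
      (use assms sent sentences[OF that] that in \<open>auto intro: Asm EqI\<close>)
qed

lemma Neg_in: "sentence_over H \<phi> \<Longrightarrow> (\<^bold>\<not> \<phi>) \<in> \<Delta> \<longleftrightarrow> \<phi> \<notin> \<Delta>"
  using closed[of "{\<phi>, \<^bold>\<not> \<phi>}" "\<^bold>\<bottom>", OF _ _ derives_NegE[of _ _ \<phi>]] maximal consistent
  by (auto intro: Asm)

lemma Imp_in:
  assumes "sentence_over H \<phi>" "sentence_over H \<psi>"
  shows "(\<phi> \<^bold>\<longrightarrow> \<psi>) \<in> \<Delta> \<longleftrightarrow> (\<phi> \<in> \<Delta> \<longrightarrow> \<psi> \<in> \<Delta>)"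
proof
  assume "(\<phi> \<^bold>\<longrightarrow> \<psi>) \<in> \<Delta>"
  then show "\<phi> \<in> \<Delta> \<longrightarrow> \<psi> \<in> \<Delta>"
    using closed[of "{\<phi>, \<phi> \<^bold>\<longrightarrow> \<psi>}" \<psi>, OF _ _ ImpE[of _ _ \<phi>]] assms by (auto intro: Asm)
next
  have "derives T {\<psi>} (\<phi> \<^bold>\<longrightarrow> \<psi>)" by (rule ImpI) (simp add: Asm)
  moreover have "derives T {\<^bold>\<not> \<phi>} (\<phi> \<^bold>\<longrightarrow> \<psi>)"
    by (rule ImpI, rule derives_Fls, rule derives_NegE[of _ _ \<phi>]) (simp_all add: Asm)
  moreover assume "\<phi> \<in> \<Delta> \<longrightarrow> \<psi> \<in> \<Delta>"
  ultimately show "(\<phi> \<^bold>\<longrightarrow> \<psi>) \<in> \<Delta>"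
    using closed[of "{\<psi>}" "\<phi> \<^bold>\<longrightarrow> \<psi>"] closed[of "{\<^bold>\<not> \<phi>}" "\<phi> \<^bold>\<longrightarrow> \<psi>"] Neg_in assms by auto
qed

lemma AllN_in:
  assumes "sentence_over H (\<^bold>\<forall>x. \<phi>)"
  shows "(\<^bold>\<forall>x. \<phi>) \<in> \<Delta> \<longleftrightarrow> (\<forall>h\<in>H. substN (Var h) x \<phi> \<in> \<Delta>)"
proof -
  have "substN (Var h) x \<phi> \<in> \<Delta>" if "(\<^bold>\<forall>x. \<phi>) \<in> \<Delta>" "h \<in> H" for h
    by (rule closed[of "{\<^bold>\<forall>x. \<phi>}", OF _ _ AllNE])
      (use that assms sentence_over_substN[OF assms that(2)]
        in \<open>auto intro!: Asm free_forN_fresh simp: sentence_over_def\<close>)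
  then show ?thesis
    using witnessN[of x \<phi>] Neg_in[OF assms] Neg_in[OF sentence_over_substN[OF assms]] by blast
qed

lemma AllS_in:
  assumes "sentence_over H (\<^bold>\<forall>\<^sub>sX. \<phi>)"
  shows "(\<^bold>\<forall>\<^sub>sX. \<phi>) \<in> \<Delta> \<longleftrightarrow> (\<forall>Z\<in>H. substS Z X \<phi> \<in> \<Delta>)"
proof -
  have "substS Z X \<phi> \<in> \<Delta>" if "(\<^bold>\<forall>\<^sub>sX. \<phi>) \<in> \<Delta>" "Z \<in> H" for Z
    by (rule closed[of "{\<^bold>\<forall>\<^sub>sX. \<phi>}", OF _ _ AllSE])
      (use that assms sentence_over_substS[OF assms that(2)]
        in \<open>auto intro!: Asm free_forS_fresh simp: sentence_over_def\<close>)
  then show ?thesis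
    using witnessS[of X \<phi>] Neg_in[OF assms] Neg_in[OF sentence_over_substS[OF assms]] by blast
qed

text \<open>Something equals \<open>t\<close>, so the Henkin property provides a name for it.
  Instances at names therefore exhaust the elements of the term model, although these are classes of
  arbitrary terms.\<close>

lemma ex_name_eq:
  assumes t: "t \<in> terms" obtains h where "h \<in> H" "(t \<^bold>= Var h) \<in> \<Delta>"
proof -
  obtain x where x: "x \<notin> H"
    using inf_compl infinite_imp_nonempty by fastforce
  let ?\<phi> = "\<^bold>\<not> t \<^bold>= Var x"
  have sent: "sentence_over H (\<^bold>\<forall>x. ?\<phi>)" using t x by (auto simp: sentence_over_def Neg_def terms_def)
  have *: "subst_tm s x t = t" for s using t x by (auto simp: terms_def intro: subst_tm_id)
  have refl: "(t \<^bold>= t) \<in> \<Delta>" "sentence_over H (t \<^bold>= t)"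
    using refl_in sentences t by blast+
  have "(\<^bold>\<forall>x. ?\<phi>) \<notin> \<Delta>"
  proof
    assume A: "(\<^bold>\<forall>x. ?\<phi>) \<in> \<Delta>"
    have "derives T {\<^bold>\<forall>x. ?\<phi>} (substN t x ?\<phi>)"
      by (rule AllNE) (auto intro: Asm simp: Neg_def)
    then have "(\<^bold>\<not> t \<^bold>= t) \<in> \<Delta>"
      using A refl closed[of "{\<^bold>\<forall>x. ?\<phi>}"] by (simp add: * Neg_def)
    then show False using refl Neg_in by blast
  qed
  then obtain h where h: "h \<in> H" "substN (Var h) x ?\<phi> \<notin> \<Delta>" using AllN_in[OF sent] by blast
  then have "(\<^bold>\<not> t \<^bold>= Var h) \<notin> \<Delta>" by (simp add: * Neg_def)
  then have "(t \<^bold>= Var h) \<in> \<Delta>" using Neg_in t h(1) by (auto simp: terms_def)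
  then show thesis using that h(1) by blast
qed

definition eq_class :: "tm \<Rightarrow> tm set" where
  "eq_class t = {s. (t \<^bold>= s) \<in> \<Delta>}"

lemma eq_class_eq: "s \<in> terms \<Longrightarrow> t \<in> terms \<Longrightarrow> eq_class s = eq_class t \<longleftrightarrow> (s \<^bold>= t) \<in> \<Delta>"
  unfolding eq_class_def using refl_in sym_in trans_in by blast

end

locale henkin_arith = henkin_set +
  assumes basic: "basic_axioms \<subseteq> T"
begin

text \<open>The two successor axioms refute equality of distinct numerals, which makes the term
  model infinite.\<close>

lemma num_eq_in: "(num m \<^bold>= num n) \<in> \<Delta> \<Longrightarrow> m = n"
proof -
  have closed_num: "fv_tm (num k) = {}" for k by (induction k) auto
  have num_subst: "subst_tm t x (num k) = num k" for t x k
    using closed_num by (simp add: subst_tm_id)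
  have sent: "sentence_over H (num k \<^bold>= num l)" for k l by (simp add: closed_num)
  have ne: "derives T {} (\<^bold>\<not> num (Suc k) \<^bold>= num 0)" for k
  proof -
    have "derives T {} (\<^bold>\<forall>''n''. \<^bold>\<not> Var ''n'' \<^bold>+ One \<^bold>= Zero)"
      by (rule AllNI, rule Axm) (use basic in \<open>auto simp: basic_axioms_def Let_def\<close>)
    then show ?thesis
      using AllNE[of T "{}" "''n''" _ "num k"] by (fastforce simp: Neg_def)
  qed
  have inj: "derives T {} (num (Suc k) \<^bold>= num (Suc l) \<^bold>\<longrightarrow> num k \<^bold>= num l)" for k l
  proof -
    have "derives T {} (\<^bold>\<forall>''m''. \<^bold>\<forall>''n''. Var ''m'' \<^bold>+ One \<^bold>= Var ''n'' \<^bold>+ One \<^bold>\<longrightarrow> Var ''m'' \<^bold>= Var ''n'')"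
      by (rule AllNI, rule AllNI, rule Axm) (use basic in \<open>auto simp: basic_axioms_def Let_def\<close>)
    then have "derives T {} (\<^bold>\<forall>''n''. num (Suc k) \<^bold>= Var ''n'' \<^bold>+ One \<^bold>\<longrightarrow> num k \<^bold>= Var ''n'')"
      using AllNE[of T "{}" "''m''" _ "num k"] by (fastforce simp: closed_num)
    then show ?thesis
      using AllNE[of T "{}" "''n''" _ "num l"] by (fastforce simp: num_subst)
  qed
  have no: "(num (Suc k) \<^bold>= num 0) \<notin> \<Delta>" for k
    using closed[OF _ _ ne[of k]] Neg_in[of "num (Suc k) \<^bold>= num 0"] sent by auto
  assume "(num m \<^bold>= num n) \<in> \<Delta>"
  then show "m = n"
  proof (induction m arbitrary: n)
    case 0
    then show ?case using no sym_in by (cases n) auto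
  next
    case (Suc m)
    then obtain n' where n': "n = Suc n'" using no by (cases n) auto
    have "(num m \<^bold>= num n') \<in> \<Delta>"
      using closed[OF _ _ inj[of m n']] Imp_in[OF sent[of "Suc m" "Suc n'"] sent[of m n']] Suc.prems sent n' by auto
    then show ?case using Suc.IH n' by blast
  qed
qed

text \<open>Numbers the equality classes; as they are countably infinite in number, this is a
  bijection onto \<open>nat\<close>.\<close>

definition val_of :: "tm \<Rightarrow> nat" where
  "val_of t = to_nat_on (eq_class ` terms) (eq_class t)"

lemma bij_classes: "bij_betw (to_nat_on (eq_class ` terms)) (eq_class ` terms) UNIV"
proof (rule to_nat_on_infinite)
  show "countable (eq_class ` terms)" by simp
  have "inj (\<lambda>n. eq_class (num n))" by (rule injI) (use num_eq_in eq_class_eq in auto)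
  then have "infinite (range (\<lambda>n. eq_class (num n)))" by (rule range_inj_infinite)
  then show "infinite (eq_class ` terms)" by (rule infinite_super[rotated]) auto
qed

lemma val_of_eq: "s \<in> terms \<Longrightarrow> t \<in> terms \<Longrightarrow> val_of s = val_of t \<longleftrightarrow> (s \<^bold>= t) \<in> \<Delta>"
  unfolding val_of_def using inj_on_eq_iff[OF bij_betw_imp_inj_on[OF bij_classes]] eq_class_eq
  by auto

lemma val_of_surj: "\<exists>t. t \<in> terms \<and> val_of t = a"
proof -
  have "a \<in> to_nat_on (eq_class ` terms) ` (eq_class ` terms)"
    using bij_betw_imp_surj_on[OF bij_classes] by simp
  then show ?thesis unfolding val_of_def by blast
qed

text \<open>Representatives through which the operations of the term model are defined; by
  \<open>cong_in\<close> their choice is immaterial.\<close>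

definition term_of :: "nat \<Rightarrow> tm" where
  "term_of a = (SOME t. t \<in> terms \<and> val_of t = a)"

lemma term_of [simp]: "term_of a \<in> terms" "val_of (term_of a) = a"
  unfolding term_of_def using someI_ex[OF val_of_surj] by blast+

lemma term_of_val_of: "t \<in> terms \<Longrightarrow> (term_of (val_of t) \<^bold>= t) \<in> \<Delta>"
  using val_of_eq term_of by blast

definition extension :: "name \<Rightarrow> nat set" where
  "extension X = {val_of t | t. t \<in> terms \<and> (t \<^bold>\<in> X) \<in> \<Delta>}"

definition term_interp :: "nat interp" where
  "term_interp = \<lparr>zero_of = val_of Zero, one_of = val_of One,
     plus_of = \<lambda>a b. val_of (term_of a \<^bold>+ term_of b),
     times_of = \<lambda>a b. val_of (term_of a \<^bold>\<cdot> term_of b),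
     less_of = \<lambda>a b. (term_of a \<^bold>< term_of b) \<in> \<Delta>,
     sets_of = extension ` H\<rparr>"

lemma tval_term_interp: "t \<in> terms \<Longrightarrow> tval term_interp (\<lambda>x. val_of (Var x)) t = val_of t"
  by (induction t) (auto simp: term_interp_def val_of_eq intro!: cong_in term_of_val_of)

text \<open>The truth lemma. Quantifiers reduce to instances at names in \<open>H\<close>: every
  number is the value of such a name, and the sets of the model are by definition the extensions of
  such names.\<close>

lemma sat_term_interp:
  "sentence_over H \<phi> \<Longrightarrow> sat term_interp (\<lambda>x. val_of (Var x)) extension \<phi> \<longleftrightarrow> \<phi> \<in> \<Delta>"
proof (induction "rank \<phi>" arbitrary: \<phi> rule: less_induct)
  case less
  show ?case
  proof (cases \<phi>)
    case Fls
    then show ?thesis using consistent by simp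
  next
    case (Eq s t)
    then show ?thesis using less.prems by (simp add: tval_term_interp val_of_eq terms_def)
  next
    case (Less s t)
    then have "s \<in> terms" "t \<in> terms" using less.prems by (auto simp: terms_def)
    then show ?thesis unfolding Less
      using cong_in(3)[OF term_of_val_of[of s] term_of_val_of[of t]]
        cong_in(3)[OF sym_in[OF term_of_val_of[of s]] sym_in[OF term_of_val_of[of t]]]
      by (simp add: tval_term_interp) (auto simp: term_interp_def)
  next
    case (Mem t X)
    then have "t \<in> terms" using less.prems by (auto simp: terms_def)
    then show ?thesis unfolding Mem
      using cong_in(4)[OF sym_in sym_in] by (auto simp: tval_term_interp extension_def val_of_eq)
  next
    case (Imp \<psi> \<chi>)
    then show ?thesis using less by (simp add: Imp_in)
  next
    case (AllN x \<psi>)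
    have fresh: "h \<notin> bv \<psi>" if "h \<in> H" for h
      using less.prems that by (auto simp: AllN sentence_over_def)
    have "sat term_interp (\<lambda>x. val_of (Var x)) extension \<phi> \<longleftrightarrow>
        (\<forall>h\<in>H. sat term_interp ((\<lambda>x. val_of (Var x))(x := val_of (Var h))) extension \<psi>)"
    proof -
      have "\<exists>h\<in>H. a = val_of (Var h)" for a
        using ex_name_eq[OF term_of(1)[of a]] val_of_eq[of "term_of a"] by fastforce
      then show ?thesis unfolding AllN by (simp, metis)
    qed
    also have "\<dots> \<longleftrightarrow> (\<forall>h\<in>H. substN (Var h) x \<psi> \<in> \<Delta>)"
    proof (rule ball_cong[OF refl])
      fix h assume h: "h \<in> H"
      have "sentence_over H (substN (Var h) x \<psi>)"
        using less.prems h sentence_over_substN unfolding AllN by blast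
      then show "sat term_interp ((\<lambda>x. val_of (Var x))(x := val_of (Var h))) extension \<psi> \<longleftrightarrow>
          substN (Var h) x \<psi> \<in> \<Delta>"
        using less.hyps[of "substN (Var h) x \<psi>"] fresh[OF h] by (simp add: AllN sat_substN)
    qed
    also have "\<dots> \<longleftrightarrow> \<phi> \<in> \<Delta>" using AllN_in less.prems unfolding AllN by blast
    finally show ?thesis .
  next
    case (AllS X \<psi>)
    have fresh: "h \<notin> bv \<psi>" if "h \<in> H" for h
      using less.prems that by (auto simp: AllS sentence_over_def)
    have "sat term_interp (\<lambda>x. val_of (Var x)) extension \<phi> \<longleftrightarrow>
        (\<forall>Z\<in>H. sat term_interp (\<lambda>x. val_of (Var x)) (extension(X := extension Z)) \<psi>)"
      unfolding AllS by (simp add: term_interp_def)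
    also have "\<dots> \<longleftrightarrow> (\<forall>Z\<in>H. substS Z X \<psi> \<in> \<Delta>)"
    proof (rule ball_cong[OF refl])
      fix Z assume Z: "Z \<in> H"
      have "sentence_over H (substS Z X \<psi>)"
        using less.prems Z sentence_over_substS unfolding AllS by blast
      then show "sat term_interp (\<lambda>x. val_of (Var x)) (extension(X := extension Z)) \<psi> \<longleftrightarrow>
          substS Z X \<psi> \<in> \<Delta>"
        using less.hyps[of "substS Z X \<psi>"] fresh[OF Z] by (simp add: AllS sat_substS)
    qed
    also have "\<dots> \<longleftrightarrow> \<phi> \<in> \<Delta>" using AllS_in less.prems unfolding AllS by blast
    finally show ?thesis .
  qed
qed

text \<open>Membership in \<open>\<Delta>\<close> decides sentences only, so the free names are
  first closed off one by one by generalisation. Since they become bound, they have to lie outside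
  \<open>H\<close>.\<close>

lemma sat_derivable:
  assumes "derives T {} \<phi>" "bv \<phi> \<inter> H = {}" "fvN \<phi> \<inter> H = {}" "fvS \<phi> \<inter> H = {}"
    and E: "\<And>X. E X \<in> sets_of term_interp"
  shows "sat term_interp e E \<phi>"
  using assms(1-4)
proof (induction "card (fvN \<phi>) + card (fvS \<phi>)" arbitrary: \<phi> rule: less_induct)
  case less
  show ?case
  proof (cases "fvN \<phi> = {}")
    case False
    then obtain x where x: "x \<in> fvN \<phi>" by blast
    have "sat term_interp e E (\<^bold>\<forall>x. \<phi>)"
    proof (rule less.hyps)
      have "card (fvN \<phi> - {x}) < card (fvN \<phi>)" using x by (intro psubset_card_mono) auto
      then show "card (fvN (\<^bold>\<forall>x. \<phi>)) + card (fvS (\<^bold>\<forall>x. \<phi>)) < card (fvN \<phi>) + card (fvS \<phi>)" by simp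
      show "derives T {} (\<^bold>\<forall>x. \<phi>)" by (rule AllNI) (use less.prems in auto)
    qed (use less.prems x in auto)
    then have "sat term_interp (e(x := e x)) E \<phi>" unfolding sat.simps by blast
    then show ?thesis by simp
  next
    case N: True
    show ?thesis
    proof (cases "fvS \<phi> = {}")
      case False
      then obtain X where X: "X \<in> fvS \<phi>" by blast
      have "sat term_interp e E (\<^bold>\<forall>\<^sub>sX. \<phi>)"
      proof (rule less.hyps)
        have "card (fvS \<phi> - {X}) < card (fvS \<phi>)" using X by (intro psubset_card_mono) auto
        then show "card (fvN (\<^bold>\<forall>\<^sub>sX. \<phi>)) + card (fvS (\<^bold>\<forall>\<^sub>sX. \<phi>)) < card (fvN \<phi>) + card (fvS \<phi>)" by simp
        show "derives T {} (\<^bold>\<forall>\<^sub>sX. \<phi>)" by (rule AllSI) (use less.prems in auto)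
      qed (use less.prems X in auto)
      then have "sat term_interp e (E(X := E X)) \<phi>" unfolding sat.simps using E by blast
      then show ?thesis by simp
    next
      case True
      then have "sentence_over H \<phi>" using N less.prems by (auto simp: sentence_over_def)
      moreover from this have "\<phi> \<in> \<Delta>" using closed[of "{}" \<phi>] less.prems by simp
      ultimately have "sat term_interp (\<lambda>x. val_of (Var x)) extension \<phi>" using sat_term_interp by blast
      then show ?thesis using sat_cong[of \<phi>] N True by (metis empty_iff)
    qed
  qed
qed

end

text \<open>An unprovable sentence would have its negation in some Henkin set and hence fail in the
  term model of that set, which satisfies all of \<open>T\<close>.\<close>

theorem completeness:
  assumes H: "infinite H" "infinite (- H)" and basic: "basic_axioms \<subseteq> T"
    and T: "\<And>\<psi>. \<psi> \<in> T \<Longrightarrow> (bv \<psi> \<union> fvN \<psi> \<union> fvS \<psi>) \<inter> H = {}"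
    and \<phi>: "bv \<phi> \<inter> H = {}" "fvN \<phi> = {}" "fvS \<phi> = {}"
    and sat: "\<And>(M :: nat interp) e E. (\<And>\<psi> e E. \<psi> \<in> T \<Longrightarrow> (\<And>X. E X \<in> sets_of M) \<Longrightarrow> sat M e E \<psi>) \<Longrightarrow>
      (\<And>X. E X \<in> sets_of M) \<Longrightarrow> sat M e E \<phi>"
  shows "T \<turnstile> \<phi>"
proof (rule ccontr)
  assume "\<not> T \<turnstile> \<phi>"
  moreover have sent: "sentence_over H \<phi>" using \<phi> by (simp add: sentence_over_def)
  ultimately obtain \<Delta> where "henkin_set T H \<Delta>" and neg: "(\<^bold>\<not> \<phi>) \<in> \<Delta>"
    using ex_henkin_set[OF H] unfolding provable_def by blast
  then interpret henkin_arith T H \<Delta> by (simp add: henkin_arith_def henkin_arith_axioms_def basic)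
  obtain h where h: "h \<in> H" using H(1) infinite_imp_nonempty by blast
  \<comment> \<open>Names outside \<open>H\<close> receive an arbitrary set of the model, since the
    hypothesis on \<open>\<phi>\<close> asks for an assignment with all values in the model; the
    sentence \<open>\<phi>\<close> does not see the difference.\<close>
  define E where "E X = (if X \<in> H then extension X else extension h)" for X
  have E: "E X \<in> sets_of term_interp" for X using h by (auto simp: E_def term_interp_def)
  have "sat term_interp e E \<psi>" if "\<psi> \<in> T" "\<And>X. E X \<in> sets_of term_interp" for \<psi> e E
    using sat_derivable[OF Axm[OF that(1)]] T[OF that(1)] that(2) by blast
  then have "sat term_interp (\<lambda>x. val_of (Var x)) E \<phi>" using E by (rule sat)
  then have "sat term_interp (\<lambda>x. val_of (Var x)) extension \<phi>" using sat_cong[of \<phi>] \<phi> by (metis empty_iff)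
  then show False using sat_term_interp[OF sent] neg Neg_in[OF sent] by blast
qed

section \<open>Arithmetic in a model\<close>

lemma connectives_simps [simp]:
  "bv (\<^bold>\<not> \<phi>) = bv \<phi>" "bv (\<phi> \<^bold>\<or> \<psi>) = bv \<phi> \<union> bv \<psi>" "bv (\<phi> \<^bold>\<and> \<psi>) = bv \<phi> \<union> bv \<psi>"
  "bv (\<phi> \<^bold>\<longleftrightarrow> \<psi>) = bv \<phi> \<union> bv \<psi>" "bv (\<^bold>\<exists>x. \<phi>) = insert x (bv \<phi>)" "bv (\<^bold>\<exists>\<^sub>sX. \<phi>) = insert X (bv \<phi>)"
  "fvN (\<^bold>\<not> \<phi>) = fvN \<phi>" "fvN (\<phi> \<^bold>\<or> \<psi>) = fvN \<phi> \<union> fvN \<psi>" "fvN (\<phi> \<^bold>\<and> \<psi>) = fvN \<phi> \<union> fvN \<psi>"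
  "fvN (\<phi> \<^bold>\<longleftrightarrow> \<psi>) = fvN \<phi> \<union> fvN \<psi>" "fvN (\<^bold>\<exists>x. \<phi>) = fvN \<phi> - {x}" "fvN (\<^bold>\<exists>\<^sub>sX. \<phi>) = fvN \<phi>"
  "fvS (\<^bold>\<not> \<phi>) = fvS \<phi>" "fvS (\<phi> \<^bold>\<or> \<psi>) = fvS \<phi> \<union> fvS \<psi>" "fvS (\<phi> \<^bold>\<and> \<psi>) = fvS \<phi> \<union> fvS \<psi>"
  "fvS (\<phi> \<^bold>\<longleftrightarrow> \<psi>) = fvS \<phi> \<union> fvS \<psi>" "fvS (\<^bold>\<exists>x. \<phi>) = fvS \<phi>" "fvS (\<^bold>\<exists>\<^sub>sX. \<phi>) = fvS \<phi> - {X}"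
  "arithmetical (\<^bold>\<not> \<phi>) = arithmetical \<phi>"
  "arithmetical (\<phi> \<^bold>\<or> \<psi>) = (arithmetical \<phi> \<and> arithmetical \<psi>)"
  "arithmetical (\<phi> \<^bold>\<and> \<psi>) = (arithmetical \<phi> \<and> arithmetical \<psi>)"
  "arithmetical (\<phi> \<^bold>\<longleftrightarrow> \<psi>) = (arithmetical \<phi> \<and> arithmetical \<psi>)"
  "arithmetical (\<^bold>\<exists>x. \<phi>) = arithmetical \<phi>"
  by (auto simp: Neg_def Or_def And_def Iff_def ExN_def ExS_def)

lemma fv_num [simp]: "fv_tm (num n) = {}"
  by (induction n) auto

lemma fv_pair [simp]: "fv_tm (pair s t) = fv_tm s \<union> fv_tm t"
  by (auto simp: pair_def)

text \<open>The names set aside for the Henkin constants; any infinite co-infinite set would do.\<close>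

definition reserved :: "name set" where
  "reserved = range (Cons CHR ''#'')"

text \<open>Even bound occurrences are excluded, since a Henkin name must be substitutable in every
  formula at hand. This cuts the schemes down to their instances in the remaining names.\<close>

definition admissible :: "fm \<Rightarrow> bool" where
  "admissible \<phi> \<longleftrightarrow> (bv \<phi> \<union> fvN \<phi> \<union> fvS \<phi>) \<inter> reserved = {}"

lemma admissible_simps [simp]:
  "admissible \<^bold>\<bottom>"
  "admissible (s \<^bold>= t) \<longleftrightarrow> (\<forall>x\<in>fv_tm s. x \<notin> reserved) \<and> (\<forall>x\<in>fv_tm t. x \<notin> reserved)"
  "admissible (s \<^bold>< t) \<longleftrightarrow> (\<forall>x\<in>fv_tm s. x \<notin> reserved) \<and> (\<forall>x\<in>fv_tm t. x \<notin> reserved)"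
  "admissible (t \<^bold>\<in> X) \<longleftrightarrow> (\<forall>x\<in>fv_tm t. x \<notin> reserved) \<and> X \<notin> reserved"
  "admissible (\<phi> \<^bold>\<longrightarrow> \<psi>) \<longleftrightarrow> admissible \<phi> \<and> admissible \<psi>"
  "admissible (\<^bold>\<forall>x. \<phi>) \<longleftrightarrow> x \<notin> reserved \<and> admissible \<phi>"
  "admissible (\<^bold>\<forall>\<^sub>sX. \<phi>) \<longleftrightarrow> X \<notin> reserved \<and> admissible \<phi>"
  "admissible (\<^bold>\<not> \<phi>) \<longleftrightarrow> admissible \<phi>"
  "admissible (\<phi> \<^bold>\<or> \<psi>) \<longleftrightarrow> admissible \<phi> \<and> admissible \<psi>"
  "admissible (\<phi> \<^bold>\<and> \<psi>) \<longleftrightarrow> admissible \<phi> \<and> admissible \<psi>"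
  "admissible (\<phi> \<^bold>\<longleftrightarrow> \<psi>) \<longleftrightarrow> admissible \<phi> \<and> admissible \<psi>"
  "admissible (\<^bold>\<exists>x. \<phi>) \<longleftrightarrow> x \<notin> reserved \<and> admissible \<phi>"
  "admissible (\<^bold>\<exists>\<^sub>sX. \<phi>) \<longleftrightarrow> X \<notin> reserved \<and> admissible \<phi>"
  unfolding admissible_def by auto

lemma reserved_simps [simp]: "[] \<notin> reserved" "c # cs \<in> reserved \<longleftrightarrow> c = CHR ''#''"
  by (auto simp: reserved_def)

lemma infinite_reserved: "infinite reserved" "infinite (- reserved)"
proof -
  show "infinite reserved"
    unfolding reserved_def by (simp add: finite_image_iff inj_on_def infinite_UNIV_listI)
  have "infinite (range (Cons CHR ''a''))"
    by (simp add: finite_image_iff inj_on_def infinite_UNIV_listI)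
  then show "infinite (- reserved)" by (rule infinite_super[rotated]) auto
qed

text \<open>Free names of axioms are read as universally closed: \<open>e\<close> is arbitrary, and
  \<open>E\<close> is arbitrary among assignments of sets of the model.\<close>

locale model =
  fixes M :: "'a interp"
  assumes axioms: "\<phi> \<in> Sigma12_DC0 \<Longrightarrow> admissible \<phi> \<Longrightarrow> (\<And>X. E X \<in> sets_of M) \<Longrightarrow> sat M e E \<phi>"
    and sets_nonempty: "sets_of M \<noteq> {}"
begin

abbreviation model_sets ("\<S>") where "\<S> \<equiv> sets_of M"
abbreviation model_zero ("\<zero>") where "\<zero> \<equiv> zero_of M"
abbreviation model_one ("\<one>") where "\<one> \<equiv> one_of M"
abbreviation model_plus (infixl "\<oplus>" 65) where "a \<oplus> b \<equiv> plus_of M a b"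
abbreviation model_times (infixl "\<otimes>" 70) where "a \<otimes> b \<equiv> times_of M a b"
abbreviation model_less (infix "\<prec>" 50) where "a \<prec> b \<equiv> less_of M a b"

section \<open>Comprehension and induction in a model\<close>

lemma comprehension:
  assumes "arithmetical \<phi>" "admissible \<phi>" "n \<notin> reserved" "\<And>X. X \<in> fvS \<phi> \<Longrightarrow> E X \<in> \<S>"
  shows "{a. sat M (e(n := a)) E \<phi>} \<in> \<S>"
proof -
  obtain A0 where A0: "A0 \<in> \<S>" using sets_nonempty by blast
  obtain X where X: "X \<notin> reserved" "X \<notin> fvS \<phi>"
    using ex_in_infinite[OF infinite_reserved(2) finite_fvS] by auto
  \<comment> \<open>The axioms are available only if every set name denotes a set of the model, so
    the names that do not occur in \<open>\<phi>\<close> are reset to \<open>A0\<close>.\<close>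
  define E' where "E' Y = (if Y \<in> fvS \<phi> then E Y else A0)" for Y
  let ?\<psi> = "\<^bold>\<exists>\<^sub>sX. \<^bold>\<forall>n. Var n \<^bold>\<in> X \<^bold>\<longleftrightarrow> \<phi>"
  have "sat M e E' ?\<psi>"
  proof (rule axioms)
    show "?\<psi> \<in> Sigma12_DC0"
      using assms(1) X(2) by (auto simp: Sigma12_DC0_def ACA0_def arithmetical_comprehension_def)
    show "admissible ?\<psi>" using assms(2,3) X by simp
    show "E' Y \<in> \<S>" for Y using assms(4) A0 by (simp add: E'_def)
  qed
  then obtain A where A: "A \<in> \<S>" "\<And>a. a \<in> A \<longleftrightarrow> sat M (e(n := a)) (E'(X := A)) \<phi>" by auto
  have "sat M (e(n := a)) (E'(X := A)) \<phi> = sat M (e(n := a)) E \<phi>" for a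
    by (rule sat_cong) (use X in \<open>auto simp: E'_def\<close>)
  then have "A = {a. sat M (e(n := a)) E \<phi>}" using A(2) by auto
  then show ?thesis using A(1) by simp
qed

lemma set_induct:
  assumes "A \<in> \<S>" "\<zero> \<in> A" "\<And>a. a \<in> A \<Longrightarrow> a \<oplus> \<one> \<in> A"
  shows "a \<in> A"
proof -
  have "sat M e (\<lambda>_. A) induction_axiom" for e
    by (rule axioms)
      (auto simp: Sigma12_DC0_def ACA0_def assms(1) induction_axiom_def)
  then show ?thesis using assms(2,3) by (auto simp: induction_axiom_def)
qed

lemma basic_axioms: "\<forall>\<phi>\<in>basic_axioms. sat M e (\<lambda>_. A) \<phi>"
proof
  fix \<phi> assume "\<phi> \<in> basic_axioms"
  obtain A0 where A0: "A0 \<in> \<S>" using sets_nonempty by blast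
  have no_sets: "fvS \<phi> = {}" "admissible \<phi>"
    using \<open>\<phi> \<in> basic_axioms\<close> by (auto simp: basic_axioms_def Let_def)
  have "sat M e (\<lambda>_. A0) \<phi>"
    using \<open>\<phi> \<in> basic_axioms\<close> A0 no_sets by (intro axioms) (auto simp: Sigma12_DC0_def ACA0_def)
  then show "sat M e (\<lambda>_. A) \<phi>" using sat_cong[of \<phi>] no_sets by (metis empty_iff)
qed

lemma suc_neq_zero [simp]: "a \<oplus> \<one> \<noteq> \<zero>"
  and suc_inj: "a \<oplus> \<one> = b \<oplus> \<one> \<Longrightarrow> a = b"
  and add_zero [simp]: "a \<oplus> \<zero> = a"
  and add_suc: "a \<oplus> (b \<oplus> \<one>) = (a \<oplus> b) \<oplus> \<one>"
  and mult_zero [simp]: "a \<otimes> \<zero> = \<zero>"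
  and mult_suc: "a \<otimes> (b \<oplus> \<one>) = a \<otimes> b \<oplus> a"
  and not_less_zero: "\<not> a \<prec> \<zero>"
  and less_suc: "a \<prec> b \<oplus> \<one> \<longleftrightarrow> a \<prec> b \<or> a = b"
  \<comment> \<open>The axioms are stated in the names \<open>m\<close> and \<open>n\<close>: the
    first instance reads them as \<open>a\<close> and \<open>b\<close>, the second reads both as
    \<open>a\<close>.\<close>
  using basic_axioms[of "(\<lambda>_. a)(''n'' := b)" "{}"] basic_axioms[of "\<lambda>_. a" "{}"]
  by (simp_all add: basic_axioms_def Let_def)

text \<open>In a nonstandard model induction holds only for sets of the model. Each law proved with
  it is therefore spelled out as an arithmetical formula of the object language.\<close>

lemma eq_induct:
  assumes "arithmetical \<phi>" "admissible \<phi>" "n \<notin> reserved" "fvS \<phi> = {}"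
    and "sat M (e(n := \<zero>)) (\<lambda>_. {}) \<phi>"
    and "\<And>a. sat M (e(n := a)) (\<lambda>_. {}) \<phi> \<Longrightarrow> sat M (e(n := a \<oplus> \<one>)) (\<lambda>_. {}) \<phi>"
  shows "sat M (e(n := a)) (\<lambda>_. {}) \<phi>"
proof -
  have "a \<in> {a. sat M (e(n := a)) (\<lambda>_. {}) \<phi>}"
    by (rule set_induct[OF comprehension]) (use assms in auto)
  then show ?thesis by simp
qed

section \<open>Laws of the semiring and of the order\<close>

lemma add_assoc: "(a \<oplus> b) \<oplus> c = a \<oplus> (b \<oplus> c)"
  using eq_induct[of "(Var ''a'' \<^bold>+ Var ''b'') \<^bold>+ Var ''n'' \<^bold>= Var ''a'' \<^bold>+ (Var ''b'' \<^bold>+ Var ''n'')" "''n''"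
    "(\<lambda>_. a)(''b'' := b)" c]
  by (simp add: add_suc)

lemma zero_add [simp]: "\<zero> \<oplus> a = a"
  using eq_induct[of "Zero \<^bold>+ Var ''n'' \<^bold>= Var ''n''" "''n''" "\<lambda>_. a" a]
  by (simp add: add_suc)

lemma suc_add: "(a \<oplus> \<one>) \<oplus> b = (a \<oplus> b) \<oplus> \<one>"
  using eq_induct[of "(Var ''a'' \<^bold>+ One) \<^bold>+ Var ''n'' \<^bold>= (Var ''a'' \<^bold>+ Var ''n'') \<^bold>+ One" "''n''" "\<lambda>_. a" b]
  by (simp add: add_suc)

lemma add_commute: "a \<oplus> b = b \<oplus> a"
  using eq_induct[of "Var ''a'' \<^bold>+ Var ''n'' \<^bold>= Var ''n'' \<^bold>+ Var ''a''" "''n''" "\<lambda>_. a" b]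
  by (simp add: add_suc suc_add)

lemma add_left_commute: "a \<oplus> (b \<oplus> c) = b \<oplus> (a \<oplus> c)"
  by (metis add_assoc add_commute)

lemmas add_ac = add_assoc add_commute add_left_commute

lemma add_right_cancel [simp]: "a \<oplus> c = b \<oplus> c \<longleftrightarrow> a = b"
  using eq_induct[of "Var ''a'' \<^bold>+ Var ''n'' \<^bold>= Var ''b'' \<^bold>+ Var ''n'' \<^bold>\<longrightarrow> Var ''a'' \<^bold>= Var ''b''" "''n''"
    "(\<lambda>_. a)(''b'' := b)" c] suc_inj[of "a \<oplus> _" "b \<oplus> _"]
  by (auto simp flip: add_assoc)

lemma add_left_cancel [simp]: "c \<oplus> a = c \<oplus> b \<longleftrightarrow> a = b"
  by (metis add_commute add_right_cancel)

lemma add_eq_self [simp]: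
  "a \<oplus> b = a \<longleftrightarrow> b = \<zero>" "a = a \<oplus> b \<longleftrightarrow> b = \<zero>" "b \<oplus> a = a \<longleftrightarrow> b = \<zero>"
  by (metis add_left_cancel add_zero add_commute)+

lemma zero_or_suc: "a = \<zero> \<or> (\<exists>b. a = b \<oplus> \<one>)"
  using eq_induct[of "Var ''n'' \<^bold>= Zero \<^bold>\<or> (\<^bold>\<exists>''b''. Var ''n'' \<^bold>= Var ''b'' \<^bold>+ One)" "''n''" "\<lambda>_. a" a]
  by simp

lemma add_eq_zero [simp]:
  "a \<oplus> b = \<zero> \<longleftrightarrow> a = \<zero> \<and> b = \<zero>" "\<zero> = a \<oplus> b \<longleftrightarrow> a = \<zero> \<and> b = \<zero>"
proof -
  show "a \<oplus> b = \<zero> \<longleftrightarrow> a = \<zero> \<and> b = \<zero>"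
    using zero_or_suc[of b] by (auto simp flip: add_assoc)
  then show "\<zero> = a \<oplus> b \<longleftrightarrow> a = \<zero> \<and> b = \<zero>" by metis
qed

lemma zero_neq_one [simp]: "\<one> \<noteq> \<zero>" "\<zero> \<noteq> \<one>"
  using suc_neq_zero[of \<zero>] by auto

lemma zero_mult [simp]: "\<zero> \<otimes> a = \<zero>"
  using eq_induct[of "Zero \<^bold>\<cdot> Var ''n'' \<^bold>= Zero" "''n''" "\<lambda>_. a" a]
  by (simp add: mult_suc)

lemma suc_mult: "(a \<oplus> \<one>) \<otimes> b = a \<otimes> b \<oplus> b"
  using eq_induct[of "(Var ''a'' \<^bold>+ One) \<^bold>\<cdot> Var ''n'' \<^bold>= Var ''a'' \<^bold>\<cdot> Var ''n'' \<^bold>+ Var ''n''" "''n''" "\<lambda>_. a" b]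
  by (simp add: mult_suc add_ac)

lemma mult_commute: "a \<otimes> b = b \<otimes> a"
  using eq_induct[of "Var ''a'' \<^bold>\<cdot> Var ''n'' \<^bold>= Var ''n'' \<^bold>\<cdot> Var ''a''" "''n''" "\<lambda>_. a" b]
  by (simp add: mult_suc suc_mult)

lemma distrib_left: "a \<otimes> (b \<oplus> c) = a \<otimes> b \<oplus> a \<otimes> c"
  using eq_induct[of "Var ''a'' \<^bold>\<cdot> (Var ''b'' \<^bold>+ Var ''n'') \<^bold>= Var ''a'' \<^bold>\<cdot> Var ''b'' \<^bold>+ Var ''a'' \<^bold>\<cdot> Var ''n''"
    "''n''" "(\<lambda>_. a)(''b'' := b)" c]
  by (simp add: mult_suc flip: add_assoc)

lemma distrib_right: "(b \<oplus> c) \<otimes> a = b \<otimes> a \<oplus> c \<otimes> a"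
  by (metis distrib_left mult_commute)

lemma mult_one [simp]: "a \<otimes> \<one> = a" "\<one> \<otimes> a = a"
  by (metis mult_suc mult_zero zero_add, metis suc_mult zero_mult zero_add)

text \<open>Both sides obey the same recursion in \<open>b\<close>. From here on comparisons are
  additive equations, which take the place of subtraction.\<close>

lemma less_iff: "a \<prec> b \<longleftrightarrow> (\<exists>d. b = a \<oplus> (d \<oplus> \<one>))"
proof -
  have step: "(\<exists>d. b \<oplus> \<one> = a \<oplus> (d \<oplus> \<one>)) \<longleftrightarrow> (\<exists>d. b = a \<oplus> (d \<oplus> \<one>)) \<or> a = b" for b
  proof -
    have "(\<exists>d. b = a \<oplus> d) \<longleftrightarrow> (\<exists>d. b = a \<oplus> (d \<oplus> \<one>)) \<or> a = b"
      by (metis add_zero zero_or_suc)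
    then show ?thesis by (simp flip: add_assoc)
  qed
  show ?thesis
    using eq_induct[of "Var ''a'' \<^bold>< Var ''n'' \<^bold>\<longleftrightarrow> (\<^bold>\<exists>''d''. Var ''n'' \<^bold>= Var ''a'' \<^bold>+ (Var ''d'' \<^bold>+ One))"
      "''n''" "\<lambda>_. a" b]
    by (auto simp: not_less_zero less_suc step)
qed

lemma linear: "(\<exists>d. b = a \<oplus> d) \<or> (\<exists>d. a = b \<oplus> (d \<oplus> \<one>))"
proof -
  have "b \<oplus> \<one> = a \<oplus> (d \<oplus> \<one>)" if "b = a \<oplus> d" for b d using that by (simp add: add_assoc)
  moreover have "(\<exists>d. b \<oplus> \<one> = a \<oplus> d) \<or> (\<exists>d. a = (b \<oplus> \<one>) \<oplus> (d \<oplus> \<one>))" if "a = b \<oplus> (d \<oplus> \<one>)" for b d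
  proof (cases "d = \<zero>")
    case True
    then have "b \<oplus> \<one> = a \<oplus> \<zero>" using that by simp
    then show ?thesis by blast
  next
    case False
    then obtain c where "d = c \<oplus> \<one>" using zero_or_suc by blast
    then have "a = (b \<oplus> \<one>) \<oplus> (c \<oplus> \<one>)" using that by (simp add: add_ac)
    then show ?thesis by blast
  qed
  moreover have "(\<exists>d. a = d \<oplus> \<one>) \<or> (\<exists>d. \<zero> = a \<oplus> d)" using zero_or_suc[of a] add_zero by metis
  ultimately show ?thesis
    using eq_induct[of "(\<^bold>\<exists>''d''. Var ''n'' \<^bold>= Var ''a'' \<^bold>+ Var ''d'') \<^bold>\<or>
      (\<^bold>\<exists>''d''. Var ''a'' \<^bold>= Var ''n'' \<^bold>+ (Var ''d'' \<^bold>+ One))" "''n''" "\<lambda>_. a" b]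
    by simp metis
qed

lemma not_less: "\<not> a \<prec> b \<longleftrightarrow> (\<exists>d. a = b \<oplus> d)"
proof -
  have "a \<noteq> (a \<oplus> (d \<oplus> \<one>)) \<oplus> c" for c d by (simp add: add_assoc)
  then show ?thesis using linear[of a b] less_iff[of a b] by metis
qed

text \<open>A larger base raises the square by at least \<open>2 q + 1\<close>, more than any addend
  up to \<open>2 q\<close> can make up for. This drives both injectivity proofs below.\<close>

lemma suc_square:
  "(q \<oplus> (d \<oplus> \<one>)) \<otimes> (q \<oplus> (d \<oplus> \<one>)) =
    (q \<otimes> q \<oplus> (q \<oplus> q)) \<oplus> ((q \<otimes> d \<oplus> d \<otimes> q \<oplus> d \<otimes> d \<oplus> d \<oplus> d) \<oplus> \<one>)"
  by (simp add: distrib_left distrib_right add_ac)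

section \<open>Injectivity of the pairing\<close>

abbreviation model_pair ("\<langle>_, _\<rangle>") where
  "\<langle>a, b\<rangle> \<equiv> (a \<oplus> b) \<otimes> (a \<oplus> b) \<oplus> a"

text \<open>With \<open>q = a \<oplus> b\<close> the addend \<open>a\<close> is at most
  \<open>q\<close>, so the left pair stays below the next square, whereas a larger sum on the right
  would reach that square. Cancellation makes this \<open>a = a \<oplus> t\<close> with nonzero
  \<open>t\<close>.\<close>

lemma pair_sum_not_less:
  assumes eq: "(a \<oplus> b) \<otimes> (a \<oplus> b) \<oplus> a = (c \<oplus> d) \<otimes> (c \<oplus> d) \<oplus> c"
    shows "\<not> (\<exists>e. c \<oplus> d = (a \<oplus> b) \<oplus> (e \<oplus> \<one>))"
proof
  assume "\<exists>e. c \<oplus> d = (a \<oplus> b) \<oplus> (e \<oplus> \<one>)"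
  then obtain e where e: "c \<oplus> d = (a \<oplus> b) \<oplus> (e \<oplus> \<one>)" by blast
  define q where "q = a \<oplus> b"
  define r where "r = q \<otimes> e \<oplus> e \<otimes> q \<oplus> e \<otimes> e \<oplus> e \<oplus> e"
  have "q \<otimes> q \<oplus> a = ((q \<otimes> q \<oplus> (q \<oplus> q)) \<oplus> (r \<oplus> \<one>)) \<oplus> c"
    using eq unfolding e q_def[symmetric] r_def suc_square .
  then have "a = (q \<oplus> q) \<oplus> (r \<oplus> \<one>) \<oplus> c" by (simp add: add_assoc)
  then have "a = a \<oplus> (b \<oplus> q \<oplus> c \<oplus> r \<oplus> \<one>)" by (simp add: q_def add_ac)
  then show False by (simp del: add_eq_zero)
qed

lemma pair_eq [simp]: "\<langle>a, b\<rangle> = \<langle>c, d\<rangle> \<longleftrightarrow> a = c \<and> b = d"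
proof
  assume eq: "\<langle>a, b\<rangle> = \<langle>c, d\<rangle>"
  then have "a \<oplus> b = c \<oplus> d"
    using pair_sum_not_less[OF eq] pair_sum_not_less[OF eq[symmetric]] linear[of "a \<oplus> b" "c \<oplus> d"]
      zero_or_suc add_zero by metis
  then show "a = c \<and> b = d" using eq by auto
qed simp


section \<open>Remainders modulo a standard number and the codes of formulas\<close>

primrec numeral_val :: "nat \<Rightarrow> 'a" where
  "numeral_val 0 = \<zero>"
| "numeral_val (Suc n) = numeral_val n \<oplus> \<one>"

lemma tval_num [simp]: "tval M e (num n) = numeral_val n"
  by (induction n) auto

lemma numeral_val_add: "numeral_val (m + n) = numeral_val m \<oplus> numeral_val n"
  by (induction n) (auto simp: add_assoc)

text \<open>Modulus and remainders are standard, the quotients arbitrary. If the quotients differed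
  by a nonzero \<open>d\<close>, the smaller side would need a remainder of at least
  \<open>k\<close>.\<close>

lemma remainder_unique:
  assumes eq: "numeral_val k \<otimes> x \<oplus> numeral_val i = numeral_val k \<otimes> y \<oplus> numeral_val j"
    and less: "i < k" "j < k"
  shows "x = y \<and> i = j"
proof -
  have aux: "d = \<zero>" if "numeral_val k \<otimes> d \<oplus> numeral_val j = numeral_val i" "i < k" for d i j
  proof (rule ccontr)
    assume "d \<noteq> \<zero>"
    then obtain c where d: "d = c \<oplus> \<one>" using zero_or_suc by blast
    obtain l where "k = i + Suc l" using less_imp_Suc_add[OF \<open>i < k\<close>] by auto
    then have k: "numeral_val k = numeral_val i \<oplus> (numeral_val l \<oplus> \<one>)"
      by (simp only: numeral_val_add numeral_val.simps)
    have "numeral_val i = (numeral_val k \<otimes> c \<oplus> numeral_val k) \<oplus> numeral_val j"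
      using that by (simp add: d mult_suc)
    also have "\<dots> = numeral_val i \<oplus> (numeral_val k \<otimes> c \<oplus> numeral_val j \<oplus> numeral_val l \<oplus> \<one>)"
      by (subst (2) k) (simp add: add_ac)
    finally show False by (simp del: numeral_val.simps)
  qed
  have inj: "m = n" if "numeral_val m = numeral_val n" for m n
    using that
  proof (induction m arbitrary: n)
    case 0 then show ?case by (cases n) auto
  next
    case (Suc m) then show ?case by (cases n) auto
  qed
  have main: "x = y \<and> i = j"
    if eq: "numeral_val k \<otimes> x \<oplus> numeral_val i = numeral_val k \<otimes> y \<oplus> numeral_val j"
      and "i < k" "y = x \<oplus> d" for x y i j d
  proof -
    have "numeral_val i = numeral_val k \<otimes> d \<oplus> numeral_val j"
      using eq by (simp add: \<open>y = x \<oplus> d\<close> distrib_left add_assoc)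
    then show ?thesis using aux[of d j i] inj \<open>i < k\<close> \<open>y = x \<oplus> d\<close> by auto
  qed
  show ?thesis
    using linear[of y x] main[OF eq less(1)] main[OF eq[symmetric] less(2)] by metis
qed

text \<open>Twice the usual pairing, the right-hand side of \<open>two_prod_encode\<close>; the
  doubled form is a polynomial without division.\<close>

definition cantor :: "'a \<Rightarrow> 'a \<Rightarrow> 'a" where
  "cantor a b = (a \<oplus> b) \<otimes> ((a \<oplus> b) \<oplus> \<one>) \<oplus> (a \<oplus> a)"

lemma cantor_sum_not_less:
  assumes eq: "cantor a b = cantor c d"
  shows "\<not> (\<exists>e. c \<oplus> d = (a \<oplus> b) \<oplus> (e \<oplus> \<one>))"
proof
  assume "\<exists>e. c \<oplus> d = (a \<oplus> b) \<oplus> (e \<oplus> \<one>)"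
  then obtain e where e: "c \<oplus> d = (a \<oplus> b) \<oplus> (e \<oplus> \<one>)" by blast
  define q where "q = a \<oplus> b"
  define r where "r = q \<otimes> e \<oplus> e \<otimes> q \<oplus> e \<otimes> e \<oplus> e \<oplus> e"
  have "q \<otimes> q \<oplus> q \<oplus> (a \<oplus> a) =
      ((q \<otimes> q \<oplus> (q \<oplus> q)) \<oplus> (r \<oplus> \<one>)) \<oplus> (q \<oplus> (e \<oplus> \<one>)) \<oplus> (c \<oplus> c)"
    using eq unfolding cantor_def mult_suc e q_def[symmetric] r_def suc_square .
  then have "a \<oplus> a = q \<oplus> ((r \<oplus> \<one>) \<oplus> (q \<oplus> (e \<oplus> \<one>)) \<oplus> (c \<oplus> c))" by (simp add: add_assoc)
  then have "a \<oplus> a = (a \<oplus> a) \<oplus> ((b \<oplus> b \<oplus> r \<oplus> e \<oplus> \<one> \<oplus> c \<oplus> c) \<oplus> \<one>)"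
    by (simp add: q_def add_ac)
  then show False by (simp del: add_eq_zero)
qed

lemma double_inj: "a \<oplus> a = b \<oplus> b \<Longrightarrow> a = b"
  using remainder_unique[of 2 a 0 b 0] by (simp add: eval_nat_numeral distrib_right)

lemma cantor_inj: "cantor a b = cantor c d \<Longrightarrow> a = c \<and> b = d"
proof -
  assume eq: "cantor a b = cantor c d"
  then have *: "a \<oplus> b = c \<oplus> d"
    using cantor_sum_not_less[OF eq] cantor_sum_not_less[OF eq[symmetric]] linear[of "a \<oplus> b" "c \<oplus> d"]
      zero_or_suc add_zero by metis
  then have "a \<oplus> a = c \<oplus> c" using eq unfolding cantor_def by (simp only: add_left_cancel)
  then have "a = c" by (rule double_inj)
  then show ?thesis using * by simp
qed

text \<open>
  Doubling the codes turns the five clauses of \<^const>\<open>code\<close> into numbers with pairwise distinct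
  remainders modulo 5.
\<close>

definition code_class :: "nat \<Rightarrow> 'a \<Rightarrow> 'a \<Rightarrow> bool" where
  "code_class r x c \<longleftrightarrow> r < 5 \<and> c \<oplus> c = numeral_val 5 \<otimes> x \<oplus> numeral_val r"

lemma code_class_unique: "code_class r x c \<Longrightarrow> code_class s y c \<Longrightarrow> r = s \<and> x = y"
  unfolding code_class_def using remainder_unique[of 5 x r y s] by auto

text \<open>Doubling \<open>5 a + 1\<close>, \<open>5 a + 3\<close> and \<open>5 a + 4\<close> gives
  \<open>5 (2 a) + 2\<close>, \<open>5 (2 a + 1) + 1\<close> and \<open>5 (2 a + 1) + 3\<close>. For
  \<open>EU\<close> the summand 10 is absorbed into the quotient as 2, leaving remainder 0. The code
  0 of falsum shares that remainder and is told apart by its quotient 0.\<close>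

lemma code_class_Prop: "code_class 2 (a \<oplus> a) (numeral_val 5 \<otimes> a \<oplus> \<one>)"
  and code_class_AX: "code_class 1 ((a \<oplus> a) \<oplus> \<one>) (numeral_val 5 \<otimes> a \<oplus> numeral_val 3)"
  and code_class_EG: "code_class 3 ((a \<oplus> a) \<oplus> \<one>) (numeral_val 5 \<otimes> a \<oplus> numeral_val 4)"
  and code_class_Imp: "code_class 4 (cantor a b) c \<longleftrightarrow>
    numeral_val 2 \<otimes> c =
      numeral_val 5 \<otimes> ((a \<oplus> b) \<otimes> ((a \<oplus> b) \<oplus> \<one>) \<oplus> numeral_val 2 \<otimes> a) \<oplus> numeral_val 4"
  and code_class_EU: "code_class 0 (cantor a b \<oplus> numeral_val 2) c \<longleftrightarrow>
    numeral_val 2 \<otimes> c =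
      numeral_val 5 \<otimes> ((a \<oplus> b) \<otimes> ((a \<oplus> b) \<oplus> \<one>) \<oplus> numeral_val 2 \<otimes> a) \<oplus> numeral_val 10"
  by (simp_all add: code_class_def cantor_def eval_nat_numeral distrib_left distrib_right add_ac)

text \<open>Brings the comparison back from doubled codes: \<open>a = c \<oplus> d\<close> would
  make \<open>c \<oplus> c\<close> exceed itself.\<close>

lemma less_of_double: "c \<oplus> c = (a \<oplus> a) \<oplus> (b \<oplus> \<one>) \<Longrightarrow> a \<prec> c"
proof (rule ccontr)
  assume eq: "c \<oplus> c = (a \<oplus> a) \<oplus> (b \<oplus> \<one>)" and "\<not> a \<prec> c"
  then obtain d where "a = c \<oplus> d" using not_less by blast
  then have "c \<oplus> c = ((c \<oplus> d) \<oplus> (c \<oplus> d)) \<oplus> (b \<oplus> \<one>)" using eq by simp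
  also have "\<dots> = (c \<oplus> c) \<oplus> ((d \<oplus> d \<oplus> b) \<oplus> \<one>)" by (simp add: add_ac)
  finally show False by (simp del: add_eq_zero)
qed

lemma less_AX: "a \<prec> numeral_val 5 \<otimes> a \<oplus> numeral_val 3"
  and less_EG: "a \<prec> numeral_val 5 \<otimes> a \<oplus> numeral_val 4"
proof -
  have "a \<prec> (numeral_val 5 \<otimes> a \<oplus> numeral_val k) \<oplus> \<one>" for k
    unfolding less_iff
    by (rule exI[of _ "numeral_val 4 \<otimes> a \<oplus> numeral_val k"])
      (simp add: eval_nat_numeral distrib_right add_ac)
  from this[of 2] this[of 3] show "a \<prec> numeral_val 5 \<otimes> a \<oplus> numeral_val 3"
    "a \<prec> numeral_val 5 \<otimes> a \<oplus> numeral_val 4"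
    by (simp_all add: eval_nat_numeral add_assoc)
qed

text \<open>Both components are bounded by \<open>cantor a b\<close>, and five copies of it contain
  two.\<close>

lemma cantor_bounds:
  "\<exists>r. numeral_val 5 \<otimes> cantor a b = (a \<oplus> a) \<oplus> r" "\<exists>r. numeral_val 5 \<otimes> cantor a b = (b \<oplus> b) \<oplus> r"
proof -
  have "numeral_val 5 \<otimes> x = x \<oplus> (x \<oplus> numeral_val 3 \<otimes> x)" for x
    by (simp add: eval_nat_numeral distrib_right add_ac)
  moreover have "cantor a b = a \<oplus> ((a \<oplus> b) \<otimes> ((a \<oplus> b) \<oplus> \<one>) \<oplus> a)"
    "cantor a b = b \<oplus> ((a \<oplus> b) \<otimes> (a \<oplus> b) \<oplus> a \<oplus> a \<oplus> a)"
    by (simp_all add: cantor_def distrib_left distrib_right add_ac)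
  ultimately have "\<exists>x r. numeral_val 5 \<otimes> cantor a b = (a \<oplus> x) \<oplus> ((a \<oplus> x) \<oplus> r)"
    "\<exists>x r. numeral_val 5 \<otimes> cantor a b = (b \<oplus> x) \<oplus> ((b \<oplus> x) \<oplus> r)"
    by metis+
  then show "\<exists>r. numeral_val 5 \<otimes> cantor a b = (a \<oplus> a) \<oplus> r"
    "\<exists>r. numeral_val 5 \<otimes> cantor a b = (b \<oplus> b) \<oplus> r"
    by (metis add_assoc add_left_commute)+
qed

text \<open>Makes the truth values of both immediate subformulas available in the history at stage
  \<open>c\<close>.\<close>

lemma code_class_cantor_less:
  assumes "code_class 4 (cantor a b) c \<or> code_class 0 (cantor a b \<oplus> numeral_val 2) c"
  shows "a \<prec> c" "b \<prec> c"
proof -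
  have "\<exists>s. c \<oplus> c = numeral_val 5 \<otimes> cantor a b \<oplus> (s \<oplus> \<one>)"
    using assms
  proof
    assume "code_class 4 (cantor a b) c"
    then show ?thesis
      by (intro exI[of _ "numeral_val 3"]) (simp add: code_class_def eval_nat_numeral)
  next
    assume "code_class 0 (cantor a b \<oplus> numeral_val 2) c"
    then show ?thesis
      \<comment> \<open>The quotient carries an extra 2, worth \<open>10 = 9 + 1\<close>; for the
        implication it is the remainder \<open>4 = 3 + 1\<close>.\<close>
      by (intro exI[of _ "numeral_val 9"])
        (simp add: code_class_def eval_nat_numeral distrib_left distrib_right add_ac)
  qed
  then obtain s where s: "c \<oplus> c = numeral_val 5 \<otimes> cantor a b \<oplus> (s \<oplus> \<one>)" by blast
  show "a \<prec> c" "b \<prec> c"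
    using cantor_bounds[of a b] s less_of_double by (metis add_assoc)+
qed

end

section \<open>Recursion along the number line\<close>

lemma tval_pair [simp]:
  "tval M e (pair s t) = plus_of M (times_of M (plus_of M (tval M e s) (tval M e t))
    (plus_of M (tval M e s) (tval M e t))) (tval M e s)"
  by (simp add: pair_def)

lemma Sigma12I: "arithmetical \<theta> \<Longrightarrow> (\<^bold>\<exists>\<^sub>sX. \<^bold>\<forall>\<^sub>sY. \<theta>) \<in> Sigma12"
  unfolding Sigma12_def by blast

context model
begin

text \<open>The semantic counterpart of \<open>(Z)\<^sup>n\<close> in the choice scheme.\<close>

definition history :: "'a \<Rightarrow> 'a set \<Rightarrow> 'a set" where
  "history n Z = {k. \<exists>i m. k = \<langle>i, m\<rangle> \<and> k \<in> Z \<and> m \<prec> n}"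

lemma pair_in_history: "\<langle>i, m\<rangle> \<in> history n Z \<longleftrightarrow> \<langle>i, m\<rangle> \<in> Z \<and> m \<prec> n"
  by (auto simp: history_def)

lemma history_in_sets:
  assumes "Z \<in> \<S>" shows "history n Z \<in> \<S>"
  using comprehension[of "\<^bold>\<exists>''i''. \<^bold>\<exists>''m''. Var ''k'' \<^bold>= pair (Var ''i'') (Var ''m'') \<^bold>\<and>
      Var ''k'' \<^bold>\<in> ''Z'' \<^bold>\<and> Var ''m'' \<^bold>< Var ''n''" "''k''" "\<lambda>_. Z" "\<lambda>_. n"] assms
  by (simp add: history_def)

lemma section_in_sets:
  assumes "Z \<in> \<S>" shows "{i. \<langle>i, n\<rangle> \<in> Z} \<in> \<S>"
  using comprehension[of "pair (Var ''i'') (Var ''n'') \<^bold>\<in> ''Z''" "''i''" "\<lambda>_. Z" "\<lambda>_. n"] assms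
  by simp

text \<open>The two equivalences by which the scheme introduces \<open>X\<close> and
  \<open>Y\<close> determine these sets; both exist in the model by arithmetical comprehension, so
  they can be inserted into \<open>\<eta>\<close>.\<close>

lemma dependent_choice:
  assumes \<eta>: "\<eta> \<in> Sigma12" "admissible \<eta>" "''Z'' \<notin> fvS \<eta>"
    and names: "n \<notin> {''k'', ''i'', ''m''}" "X \<noteq> Y" "''Z'' \<notin> {X, Y}" "{n, X, Y} \<inter> reserved = {}"
    and E: "\<And>X. E X \<in> \<S>"
    and total: "\<And>a A. A \<in> \<S> \<Longrightarrow> \<exists>B\<in>\<S>. sat M (e(n := a)) (E(X := A, Y := B)) \<eta>"
  obtains Z where "Z \<in> \<S>"
    "\<And>a. sat M (e(n := a)) (E(X := history a Z, Y := {i. \<langle>i, a\<rangle> \<in> Z})) \<eta>"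
proof -
  let ?\<phi> = "(\<^bold>\<forall>n. \<^bold>\<forall>\<^sub>sX. \<^bold>\<exists>\<^sub>sY. \<eta>) \<^bold>\<longrightarrow>
       (\<^bold>\<exists>\<^sub>s''Z''. \<^bold>\<forall>n. \<^bold>\<forall>\<^sub>sX. \<^bold>\<forall>\<^sub>sY.
          (\<^bold>\<forall>''k''. Var ''k'' \<^bold>\<in> X \<^bold>\<longleftrightarrow>
             (\<^bold>\<exists>''i''. \<^bold>\<exists>''m''. Var ''k'' \<^bold>= pair (Var ''i'') (Var ''m'') \<^bold>\<and>
                Var ''k'' \<^bold>\<in> ''Z'' \<^bold>\<and> Var ''m'' \<^bold>< Var n)) \<^bold>\<and>
          (\<^bold>\<forall>''i''. Var ''i'' \<^bold>\<in> Y \<^bold>\<longleftrightarrow> pair (Var ''i'') (Var n) \<^bold>\<in> ''Z'')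
          \<^bold>\<longrightarrow> \<eta>)"
  have "sat M e E ?\<phi>"
  proof (rule axioms)
    have "distinct [n, ''k'', ''i'', ''m'']" "distinct [X, Y, ''Z'']" using names by auto
    then show "?\<phi> \<in> Sigma12_DC0"
      unfolding Sigma12_DC0_def dependent_choice_def using \<eta> by blast
    show "admissible ?\<phi>" using \<eta>(2) names by simp
  qed (rule E)
  moreover have "sat M e E (\<^bold>\<forall>n. \<^bold>\<forall>\<^sub>sX. \<^bold>\<exists>\<^sub>sY. \<eta>)" using total by simp
  ultimately have "sat M e E (\<^bold>\<exists>\<^sub>s''Z''. \<^bold>\<forall>n. \<^bold>\<forall>\<^sub>sX. \<^bold>\<forall>\<^sub>sY.
          (\<^bold>\<forall>''k''. Var ''k'' \<^bold>\<in> X \<^bold>\<longleftrightarrow>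
             (\<^bold>\<exists>''i''. \<^bold>\<exists>''m''. Var ''k'' \<^bold>= pair (Var ''i'') (Var ''m'') \<^bold>\<and>
                Var ''k'' \<^bold>\<in> ''Z'' \<^bold>\<and> Var ''m'' \<^bold>< Var n)) \<^bold>\<and>
          (\<^bold>\<forall>''i''. Var ''i'' \<^bold>\<in> Y \<^bold>\<longleftrightarrow> pair (Var ''i'') (Var n) \<^bold>\<in> ''Z'')
          \<^bold>\<longrightarrow> \<eta>)"
    unfolding sat.simps(5) by blast
  then obtain Z where Z: "Z \<in> \<S>" and
    *: "\<And>a A B. A \<in> \<S> \<Longrightarrow> B \<in> \<S> \<Longrightarrow> A = history a Z \<Longrightarrow> B = {i. \<langle>i, a\<rangle> \<in> Z} \<Longrightarrow>
      sat M (e(n := a)) (E(''Z'' := Z, X := A, Y := B)) \<eta>"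
    using names by (auto simp: history_def)
  have "sat M (e(n := a)) (E(X := history a Z, Y := {i. \<langle>i, a\<rangle> \<in> Z})) \<eta>" for a
  proof -
    have "sat M (e(n := a)) (E(''Z'' := Z, X := history a Z, Y := {i. \<langle>i, a\<rangle> \<in> Z})) \<eta>"
      by (rule *[OF history_in_sets[OF Z] section_in_sets[OF Z]]) auto
    also have "sat M (e(n := a)) (E(''Z'' := Z, X := history a Z, Y := {i. \<langle>i, a\<rangle> \<in> Z})) \<eta> =
        sat M (e(n := a)) (E(X := history a Z, Y := {i. \<langle>i, a\<rangle> \<in> Z})) \<eta>"
      by (rule sat_cong) (use \<eta>(3) in auto)
    finally show ?thesis .
  qed
  then show thesis using that Z by blast
qed

text \<open>
  A \<open>\<Sigma>\<^sup>1\<^sub>1\<close> condition need not have a truth set before the choice axiom has been applied, so the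
  sets \<open>Y\<close> that are chosen contain a flag for the truth of \<open>\<exists>f. \<theta>\<close> and, if the flag is set, a
  witness: \<open>0\<close> is the flag and \<open>{i. i + 1 \<in> Y}\<close> the witness. A first application of dependent
  choice, with index \<open>w\<close>, collects flags and witnesses for all numbers \<open>w\<close>; a second one,
  with index \<open>n\<close>, iterates this. The set quantifier over \<open>D\<close> is void: it gives the formulas the
  syntactic shape \<open>\<exists>D \<forall>f\<close>.
\<close>

lemma sigma11_recursion:
  assumes \<theta>: "arithmetical \<theta>" "admissible \<theta>" "fvS \<theta> \<inter> {''D'', ''P'', ''Y'', ''Z''} = {}"
    and E: "\<And>X. E X \<in> \<S>"
  obtains Z where "Z \<in> \<S>" "\<And>n w. \<langle>\<langle>\<zero>, w\<rangle>, n\<rangle> \<in> Z \<longleftrightarrow>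
    (\<exists>f\<in>\<S>. sat M (e(''n'' := n, ''w'' := w)) (E(''X'' := history n Z, ''f'' := f)) \<theta>)"
proof -
  define \<Theta> where "\<Theta> n w A f \<longleftrightarrow> sat M (e(''n'' := n, ''w'' := w)) (E(''X'' := A, ''f'' := f)) \<theta>"
    for n w A f
  have \<Theta>: "sat M (e(''n'' := n, ''w'' := w)) E' \<theta> = \<Theta> n w A f"
    if "\<And>X. X \<notin> {''D'', ''P'', ''Y'', ''Z''} \<Longrightarrow> E' X = (E(''X'' := A, ''f'' := f)) X" for E' n w A f
    unfolding \<Theta>_def
  proof (rule sat_cong)
    fix X assume "X \<in> fvS \<theta>"
    then have "X \<notin> {''D'', ''P'', ''Y'', ''Z''}" using \<theta>(3) by blast
    then show "E' X = (E(''X'' := A, ''f'' := f)) X" by (rule that)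
  qed simp
  let ?w = "Var ''w''" and ?i = "Var ''i''"
  \<comment> \<open>The decoded witness is not a term, so it is picked out among all
    \<open>f\<close> by an equivalence; the same universal quantifier over \<open>f\<close> also
    says that any solution of \<open>\<theta>\<close> raises the flag.\<close>
  define \<eta>1 where "\<eta>1 = (\<^bold>\<exists>\<^sub>s''D''. \<^bold>\<forall>\<^sub>s''f''.
    (Zero \<^bold>\<in> ''Y'' \<^bold>\<and> (\<^bold>\<forall>''i''. ?i \<^bold>\<in> ''f'' \<^bold>\<longleftrightarrow> ?i \<^bold>+ One \<^bold>\<in> ''Y'') \<^bold>\<longrightarrow> \<theta>) \<^bold>\<and> (\<theta> \<^bold>\<longrightarrow> Zero \<^bold>\<in> ''Y''))"
  \<comment> \<open>Column \<open>w\<close> of \<open>Y\<close> repeats the format of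
    \<open>\<eta>1\<close>, matching the sections \<open>{i. \<langle>i, w\<rangle> \<in> B}\<close>
    that choice over \<open>w\<close> delivers.\<close>
  define \<eta>2 where "\<eta>2 = (\<^bold>\<exists>\<^sub>s''D''. \<^bold>\<forall>\<^sub>s''f''. \<^bold>\<forall>''w''.
    (pair Zero ?w \<^bold>\<in> ''Y'' \<^bold>\<and> (\<^bold>\<forall>''i''. ?i \<^bold>\<in> ''f'' \<^bold>\<longleftrightarrow> pair (?i \<^bold>+ One) ?w \<^bold>\<in> ''Y'') \<^bold>\<longrightarrow> \<theta>) \<^bold>\<and>
    (\<theta> \<^bold>\<longrightarrow> pair Zero ?w \<^bold>\<in> ''Y''))"
  have sigma: "\<eta>1 \<in> Sigma12" "\<eta>2 \<in> Sigma12"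
    unfolding \<eta>1_def \<eta>2_def by (rule Sigma12I, simp add: \<theta>(1))+
  have adm: "admissible \<eta>1" "admissible \<eta>2"
    unfolding \<eta>1_def \<eta>2_def using \<theta>(2) by simp_all
  have fresh: "''Z'' \<notin> fvS \<eta>1" "''Z'' \<notin> fvS \<eta>2"
    using \<theta>(3) unfolding \<eta>1_def \<eta>2_def by simp_all
  have sat1: "sat M (e(''n'' := n, ''w'' := w)) (E(''X'' := A, ''P'' := C, ''Y'' := B)) \<eta>1 \<longleftrightarrow>
      (\<forall>f\<in>\<S>. (\<zero> \<in> B \<and> (\<forall>i. i \<in> f \<longleftrightarrow> i \<oplus> \<one> \<in> B) \<longrightarrow> \<Theta> n w A f) \<and> (\<Theta> n w A f \<longrightarrow> \<zero> \<in> B))"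
    for n w A B C
  proof -
    have "sat M (e(''n'' := n, ''w'' := w))
        (E(''X'' := A, ''P'' := C, ''Y'' := B, ''D'' := D, ''f'' := f)) \<theta> = \<Theta> n w A f" for D f
      by (rule \<Theta>) auto
    then show ?thesis using sets_nonempty by (simp add: \<eta>1_def ex_in_conv)
  qed
  have sat2: "sat M (e(''n'' := n)) (E(''X'' := A, ''Y'' := B)) \<eta>2 \<longleftrightarrow>
      (\<forall>f\<in>\<S>. \<forall>w. (\<langle>\<zero>, w\<rangle> \<in> B \<and> (\<forall>i. i \<in> f \<longleftrightarrow> \<langle>i \<oplus> \<one>, w\<rangle> \<in> B) \<longrightarrow> \<Theta> n w A f) \<and>
        (\<Theta> n w A f \<longrightarrow> \<langle>\<zero>, w\<rangle> \<in> B))" for n A B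
  proof -
    have "sat M (e(''n'' := n, ''w'' := w))
        (E(''X'' := A, ''Y'' := B, ''D'' := D, ''f'' := f)) \<theta> = \<Theta> n w A f" for w D f
      by (rule \<Theta>) auto
    then show ?thesis using sets_nonempty by (simp add: \<eta>2_def ex_in_conv del: zero_add)
  qed
  have total1: "\<exists>B\<in>\<S>. sat M (e(''n'' := n, ''w'' := w)) (E(''X'' := A, ''P'' := C, ''Y'' := B)) \<eta>1"
    for n w A C
  proof (cases "\<exists>f\<in>\<S>. \<Theta> n w A f")
    case True
    then obtain f where f: "f \<in> \<S>" "\<Theta> n w A f" by blast
    define B where "B = {a. a = \<zero> \<or> (\<exists>i. a = i \<oplus> \<one> \<and> i \<in> f)}"
    have "B \<in> \<S>"
      using comprehension[of "Var ''n'' \<^bold>= Zero \<^bold>\<or> (\<^bold>\<exists>''i''. Var ''n'' \<^bold>= ?i \<^bold>+ One \<^bold>\<and> ?i \<^bold>\<in> ''f'')"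
        "''n''" "\<lambda>_. f" "\<lambda>_. \<zero>"] f(1)
      by (simp add: B_def)
    moreover have "\<zero> \<in> B" by (simp add: B_def)
    moreover have "g = f" if "\<forall>i. i \<in> g \<longleftrightarrow> i \<oplus> \<one> \<in> B" for g
      using that by (auto simp: B_def)
    ultimately show ?thesis unfolding sat1 using f by (intro bexI[of _ B]) blast
  next
    case False
    \<comment> \<open>Without a solution the empty set will do: its flag is off, and both
      implications hold vacuously.\<close>
    have "{} \<in> \<S>"
      using comprehension[of "\<^bold>\<bottom>" "''n''" E e] by simp
    then show ?thesis unfolding sat1 using False by (intro bexI[of _ "{}"]) auto
  qed
  have total2: "\<exists>B\<in>\<S>. sat M (e(''n'' := n)) (E(''X'' := A, ''Y'' := B)) \<eta>2" if A: "A \<in> \<S>" for n A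
  proof -
    \<comment> \<open>The history slot gets the name \<open>P\<close>, absent from
      \<open>\<eta>1\<close>: the choices for different \<open>w\<close> are independent, with
      \<open>X\<close> as a fixed parameter.\<close>
    obtain B where B: "B \<in> \<S>" "\<And>w. sat M (e(''n'' := n, ''w'' := w))
        (E(''X'' := A, ''P'' := history w B, ''Y'' := {i. \<langle>i, w\<rangle> \<in> B})) \<eta>1"
      by (rule dependent_choice[OF sigma(1) adm(1) fresh(1), of "''w''" "''P''" "''Y''"
            "E(''X'' := A)" "e(''n'' := n)"]) (use A E total1 in auto)
    have "sat M (e(''n'' := n)) (E(''X'' := A, ''Y'' := B)) \<eta>2"
      using B(2) unfolding sat1 sat2 mem_Collect_eq by blast
    then show ?thesis using B(1) by blast
  qed
  obtain Z where Z: "Z \<in> \<S>" "\<And>n. sat M (e(''n'' := n))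
      (E(''X'' := history n Z, ''Y'' := {i. \<langle>i, n\<rangle> \<in> Z})) \<eta>2"
    by (rule dependent_choice[OF sigma(2) adm(2) fresh(2), of "''n''" "''X''" "''Y''" E e])
      (use E total2 in auto)
  have "\<langle>\<langle>\<zero>, w\<rangle>, n\<rangle> \<in> Z \<longleftrightarrow> (\<exists>f\<in>\<S>. \<Theta> n w (history n Z) f)" for n w
  proof -
    \<comment> \<open>The witness stored for \<open>w\<close> at stage \<open>n\<close>, undoing
      both pairings and the shift by one past the flag.\<close>
    have f: "{i. \<langle>\<langle>i \<oplus> \<one>, w\<rangle>, n\<rangle> \<in> Z} \<in> \<S>" (is "?f \<in> _")
      using comprehension[of "pair (pair (?i \<^bold>+ One) ?w) (Var ''n'') \<^bold>\<in> ''Z''" "''i''"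
          "\<lambda>_. Z" "(\<lambda>_. w)(''n'' := n)"] Z(1)
      by simp
    note z = Z(2)[of n, unfolded sat2 mem_Collect_eq]
    have "\<Theta> n w (history n Z) ?f" if "\<langle>\<langle>\<zero>, w\<rangle>, n\<rangle> \<in> Z"
      using spec[OF bspec[OF z f], of w] that unfolding mem_Collect_eq by blast
    moreover have "\<langle>\<langle>\<zero>, w\<rangle>, n\<rangle> \<in> Z" if "f \<in> \<S>" "\<Theta> n w (history n Z) f" for f
      using spec[OF bspec[OF z that(1)], of w] that(2) by blast
    ultimately show ?thesis using f by blast
  qed
  then show thesis using that[OF Z(1)] unfolding \<Theta>_def by blast
qed

end

section \<open>The truth set of the formulas of CTL\<close>

text \<open>Reads the flag of world \<open>s\<close> at stage \<open>t\<close> from the history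
  \<open>X\<close>. Stages that are not yet available count as false.\<close>

definition true_at :: "tm \<Rightarrow> tm \<Rightarrow> fm" where
  "true_at t s = (s \<^bold>\<in> ''W'' \<^bold>\<and> pair (pair Zero s) t \<^bold>\<in> ''X'')"

text \<open>Only the clauses for \<open>EG\<close> and \<open>EU\<close> constrain \<open>f\<close>;
  in the others any set is a witness. Falsum has no clause, hence no witness at any world.\<close>

definition witnesses :: fm where
  "witnesses =
    (let n = Var ''n''; w = Var ''w''; u = Var ''u''; a = Var ''a''; b = Var ''b'';
         i = Var ''i''; j = Var ''j''; x = Var ''x'' in
     (is_Prop n \<^bold>\<and> pair (pair w n) One \<^bold>\<in> ''v'') \<^bold>\<or>
     (\<^bold>\<exists>''a''. \<^bold>\<exists>''b''. is_Imp n a b \<^bold>\<and> (true_at a w \<^bold>\<longrightarrow> true_at b w)) \<^bold>\<or>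
     (\<^bold>\<exists>''a''. n \<^bold>= code_AX a \<^bold>\<and>
        (\<^bold>\<forall>''u''. u \<^bold>\<in> ''W'' \<^bold>\<longrightarrow> pair w u \<^bold>\<in> ''R'' \<^bold>\<longrightarrow> true_at a u)) \<^bold>\<or>
     (\<^bold>\<exists>''a''. n \<^bold>= code_EG a \<^bold>\<and> path \<^bold>\<and>
        (\<^bold>\<forall>''i''. \<^bold>\<forall>''x''. pair i x \<^bold>\<in> ''f'' \<^bold>\<longrightarrow> true_at a x)) \<^bold>\<or>
     (\<^bold>\<exists>''a''. \<^bold>\<exists>''b''. is_EU n a b \<^bold>\<and> (\<^bold>\<exists>''i''. path \<^bold>\<and>
        (\<^bold>\<forall>''j''. j \<^bold>< i \<^bold>\<longrightarrow> (\<^bold>\<forall>''x''. pair j x \<^bold>\<in> ''f'' \<^bold>\<longrightarrow> true_at a x)) \<^bold>\<and>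
        (\<^bold>\<forall>''x''. pair i x \<^bold>\<in> ''f'' \<^bold>\<longrightarrow> true_at b x))))"

lemma fv_path: "fvN path = {''w''}" "fvS path = {''W'', ''R'', ''f''}"
  by (auto simp: path_def Let_def)

lemma path_syntax [simp]: "arithmetical path" "admissible path"
  by (simp_all add: path_def Let_def)

lemma witnesses_syntax:
  "arithmetical witnesses" "admissible witnesses" "fvS witnesses = {''W'', ''R'', ''v'', ''X'', ''f''}"
  by (auto simp: witnesses_def true_at_def is_Prop_def is_Imp_def is_EU_def code_AX_def code_EG_def
      Let_def fv_path)

context model
begin

text \<open>\<open>path\<close> is kept as an opaque predicate of its four free names, because the
  same formula occurs in the recursion and in the definition of a valuation. The values given to
  other names are dummies.\<close>

definition is_path :: "'a set \<Rightarrow> 'a set \<Rightarrow> 'a \<Rightarrow> 'a set \<Rightarrow> bool" where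
  "is_path W R w f \<longleftrightarrow>
    sat M (\<lambda>_. w) ((\<lambda>_. {})(''W'' := W, ''R'' := R, ''f'' := f)) path"

lemma sat_path [simp]: "sat M e E path = is_path (E ''W'') (E ''R'') (e ''w'') (E ''f'')"
  unfolding is_path_def by (rule sat_cong) (auto simp: fv_path)

definition truth :: "'a set \<Rightarrow> 'a set \<Rightarrow> 'a \<Rightarrow> 'a \<Rightarrow> bool" where
  "truth W Z a w \<longleftrightarrow> w \<in> W \<and> \<langle>\<langle>\<zero>, w\<rangle>, a\<rangle> \<in> Z"

lemma double_eq [simp]: "a \<oplus> a = b \<oplus> b \<longleftrightarrow> a = b"
  using double_inj by blast

lemma code_Prop_iff: "n = numeral_val 5 \<otimes> a \<oplus> \<one> \<longleftrightarrow> code_class 2 (a \<oplus> a) n"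
  and code_AX_iff: "n = numeral_val 5 \<otimes> a \<oplus> numeral_val 3 \<longleftrightarrow> code_class 1 ((a \<oplus> a) \<oplus> \<one>) n"
  and code_EG_iff: "n = numeral_val 5 \<otimes> a \<oplus> numeral_val 4 \<longleftrightarrow> code_class 3 ((a \<oplus> a) \<oplus> \<one>) n"
proof -
  have "n = m" if "code_class r x n" "code_class r x m" for r x n m
    using that double_inj[of n m] unfolding code_class_def by simp
  then show "n = numeral_val 5 \<otimes> a \<oplus> \<one> \<longleftrightarrow> code_class 2 (a \<oplus> a) n"
    "n = numeral_val 5 \<otimes> a \<oplus> numeral_val 3 \<longleftrightarrow> code_class 1 ((a \<oplus> a) \<oplus> \<one>) n"
    "n = numeral_val 5 \<otimes> a \<oplus> numeral_val 4 \<longleftrightarrow> code_class 3 ((a \<oplus> a) \<oplus> \<one>) n"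
    using code_class_Prop code_class_AX code_class_EG by blast+
qed

lemma sat_code_simps:
  "sat M e E (is_Prop t) \<longleftrightarrow> (\<exists>k. tval M (e(''k'' := k)) t = numeral_val 5 \<otimes> k \<oplus> \<one>)"
  "sat M e E (is_Imp t r s) \<longleftrightarrow> code_class 4 (cantor (tval M e r) (tval M e s)) (tval M e t)"
  "sat M e E (is_EU t r s) \<longleftrightarrow>
    code_class 0 (cantor (tval M e r) (tval M e s) \<oplus> numeral_val 2) (tval M e t)"
  "tval M e (code_AX t) = numeral_val 5 \<otimes> tval M e t \<oplus> numeral_val 3"
  "tval M e (code_EG t) = numeral_val 5 \<otimes> tval M e t \<oplus> numeral_val 4"
  by (simp_all add: is_Prop_def is_Imp_def is_EU_def code_AX_def code_EG_def code_class_Imp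
      code_class_EU del: numeral_val.simps)

end

text \<open>The truth conditions with codes in place of formulas, as the interface between the
  recursion and the valuation. Each right-hand side repeats \<open>w \<in> W\<close> (in the falsum
  clause there is nothing to repeat) because \<open>truth\<close> includes it.\<close>

locale truth_set = model +
  fixes W R v Z
  assumes zero_clause: "\<not> truth W Z \<zero> w"
    and Prop_clause: "truth W Z (numeral_val 5 \<otimes> k \<oplus> \<one>) w \<longleftrightarrow>
      w \<in> W \<and> \<langle>\<langle>w, numeral_val 5 \<otimes> k \<oplus> \<one>\<rangle>, \<one>\<rangle> \<in> v"
    and Imp_clause: "code_class 4 (cantor a b) c \<Longrightarrow>
      truth W Z c w \<longleftrightarrow> w \<in> W \<and> (truth W Z a w \<longrightarrow> truth W Z b w)"
    and AX_clause: "truth W Z (numeral_val 5 \<otimes> a \<oplus> numeral_val 3) w \<longleftrightarrow>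
      w \<in> W \<and> (\<forall>u. u \<in> W \<longrightarrow> \<langle>w, u\<rangle> \<in> R \<longrightarrow> truth W Z a u)"
    and EG_clause: "truth W Z (numeral_val 5 \<otimes> a \<oplus> numeral_val 4) w \<longleftrightarrow>
      w \<in> W \<and> (\<exists>f\<in>\<S>. is_path W R w f \<and> (\<forall>i x. \<langle>i, x\<rangle> \<in> f \<longrightarrow> truth W Z a x))"
    and EU_clause: "code_class 0 (cantor a b \<oplus> numeral_val 2) c \<Longrightarrow>
      truth W Z c w \<longleftrightarrow> w \<in> W \<and> (\<exists>f\<in>\<S>. \<exists>i. is_path W R w f \<and>
        (\<forall>j. j \<prec> i \<longrightarrow> (\<forall>x. \<langle>j, x\<rangle> \<in> f \<longrightarrow> truth W Z a x)) \<and>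
        (\<forall>x. \<langle>i, x\<rangle> \<in> f \<longrightarrow> truth W Z b x))"

text \<open>Immediate subformulas have smaller codes, so their values in the history are the final
  ones; and a code fixes the kind of its formula and its components, so exactly the matching
  disjunct of \<open>witnesses\<close> survives.\<close>

lemma (in model) ex_truth_set:
  assumes "W \<in> \<S>" "R \<in> \<S>" "v \<in> \<S>"
  shows "\<exists>Z\<in>\<S>. truth_set M W R v Z"
proof -
  let ?E = "(\<lambda>_. v)(''W'' := W, ''R'' := R)"
  obtain Z where Z: "Z \<in> \<S>" "\<And>n w. \<langle>\<langle>\<zero>, w\<rangle>, n\<rangle> \<in> Z \<longleftrightarrow>
      (\<exists>f\<in>\<S>. sat M ((\<lambda>_. \<zero>)(''n'' := n, ''w'' := w)) (?E(''X'' := history n Z, ''f'' := f)) witnesses)"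
    by (rule sigma11_recursion[OF witnesses_syntax(1,2), of ?E "\<lambda>_. \<zero>"])
      (use assms in \<open>simp_all add: witnesses_syntax(3)\<close>)
  define h where "h n a w \<longleftrightarrow> w \<in> W \<and> \<langle>\<langle>\<zero>, w\<rangle>, a\<rangle> \<in> history n Z" for n a w
  have h: "h n a w \<longleftrightarrow> truth W Z a w" if "a \<prec> n" for n a w
    using that by (simp add: h_def truth_def pair_in_history del: zero_add)
  have Z_iff: "truth W Z n w \<longleftrightarrow> w \<in> W \<and> (\<exists>f\<in>\<S>.
      (\<exists>k. code_class 2 (k \<oplus> k) n) \<and> \<langle>\<langle>w, n\<rangle>, \<one>\<rangle> \<in> v \<or>
      (\<exists>a b. code_class 4 (cantor a b) n \<and> (h n a w \<longrightarrow> h n b w)) \<or>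
      (\<exists>a. code_class 1 ((a \<oplus> a) \<oplus> \<one>) n \<and> (\<forall>u. u \<in> W \<longrightarrow> \<langle>w, u\<rangle> \<in> R \<longrightarrow> h n a u)) \<or>
      (\<exists>a. code_class 3 ((a \<oplus> a) \<oplus> \<one>) n \<and> is_path W R w f \<and> (\<forall>i x. \<langle>i, x\<rangle> \<in> f \<longrightarrow> h n a x)) \<or>
      (\<exists>a b. code_class 0 (cantor a b \<oplus> numeral_val 2) n \<and> (\<exists>i. is_path W R w f \<and>
        (\<forall>j. j \<prec> i \<longrightarrow> (\<forall>x. \<langle>j, x\<rangle> \<in> f \<longrightarrow> h n a x)) \<and> (\<forall>x. \<langle>i, x\<rangle> \<in> f \<longrightarrow> h n b x))))" for n w
    unfolding truth_def Z(2) h_def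
    by (simp add: witnesses_def true_at_def sat_code_simps Let_def code_Prop_iff code_AX_iff code_EG_iff
        del: zero_add numeral_val.simps)
  \<comment> \<open>Once the class of \<open>n\<close> is known, disjuncts with another remainder
    become false and the existential quantifiers over subformula codes collapse.\<close>
  have class_iff: "code_class s y n \<longleftrightarrow> s = r \<and> y = x" if "code_class r x n" for r x n s y
    using that code_class_unique by blast
  have cantor_eq: "cantor a b = cantor c d \<longleftrightarrow> a = c \<and> b = d" for a b c d
    using cantor_inj by blast
  \<comment> \<open>For the clauses that do not mention \<open>f\<close>, the quantifier over
    witnesses is discharged by any set of the model.\<close>
  have ex_set: "\<exists>f. f \<in> \<S>" using Z(1) by blast
  have "truth_set M W R v Z"
  proof unfold_locales
    fix w a b c k
    \<comment> \<open>The only disjunct with remainder 0 is that for \<open>EU\<close>; its quotient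
      is at least 2, while here it is 0.\<close>
    have "code_class 0 \<zero> \<zero>" by (simp add: code_class_def)
    note zero = class_iff[OF this]
    show "\<not> truth W Z \<zero> w"
      unfolding Z_iff zero by (simp add: eval_nat_numeral flip: add_assoc)
    note Prop = class_iff[OF code_class_Prop[of k]]
    show "truth W Z (numeral_val 5 \<otimes> k \<oplus> \<one>) w \<longleftrightarrow>
        w \<in> W \<and> \<langle>\<langle>w, numeral_val 5 \<otimes> k \<oplus> \<one>\<rangle>, \<one>\<rangle> \<in> v"
      unfolding Z_iff Prop using ex_set by (simp del: numeral_val.simps)
    note AX = class_iff[OF code_class_AX[of a]]
    show "truth W Z (numeral_val 5 \<otimes> a \<oplus> numeral_val 3) w \<longleftrightarrow>
        w \<in> W \<and> (\<forall>u. u \<in> W \<longrightarrow> \<langle>w, u\<rangle> \<in> R \<longrightarrow> truth W Z a u)"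
      unfolding Z_iff[of _ w] AX using ex_set by (simp add: h[OF less_AX] del: numeral_val.simps)
    note EG = class_iff[OF code_class_EG[of a]]
    show "truth W Z (numeral_val 5 \<otimes> a \<oplus> numeral_val 4) w \<longleftrightarrow>
        w \<in> W \<and> (\<exists>f\<in>\<S>. is_path W R w f \<and> (\<forall>i x. \<langle>i, x\<rangle> \<in> f \<longrightarrow> truth W Z a x))"
      unfolding Z_iff[of _ w] EG by (simp add: h[OF less_EG] del: numeral_val.simps)
    show "truth W Z c w \<longleftrightarrow> w \<in> W \<and> (truth W Z a w \<longrightarrow> truth W Z b w)"
      if c: "code_class 4 (cantor a b) c"
    proof -
      have less: "a \<prec> c" "b \<prec> c" using code_class_cantor_less[of a b c] c by auto
      show ?thesis
        unfolding Z_iff[of c w] class_iff[OF c]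
        using ex_set by (simp add: h[OF less(1)] h[OF less(2)] cantor_eq)
    qed
    show "truth W Z c w \<longleftrightarrow> w \<in> W \<and> (\<exists>f\<in>\<S>. \<exists>i. is_path W R w f \<and>
        (\<forall>j. j \<prec> i \<longrightarrow> (\<forall>x. \<langle>j, x\<rangle> \<in> f \<longrightarrow> truth W Z a x)) \<and>
        (\<forall>x. \<langle>i, x\<rangle> \<in> f \<longrightarrow> truth W Z b x))"
      if c: "code_class 0 (cantor a b \<oplus> numeral_val 2) c"
    proof -
      have less: "a \<prec> c" "b \<prec> c" using code_class_cantor_less[of a b c] c by auto
      show ?thesis
        unfolding Z_iff[of c w] class_iff[OF c]
        by (simp add: h[OF less(1)] h[OF less(2)] cantor_eq)
    qed
  qed
  then show ?thesis using Z(1) by blast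
qed

context truth_set
begin

section \<open>From the truth set to the valuation\<close>

definition valuation :: "'a set" where
  "valuation = {p. \<exists>w a x. w \<in> W \<and> (x = \<zero> \<or> x = \<one>) \<and>
    (x = \<one> \<longleftrightarrow> \<langle>\<langle>\<zero>, w\<rangle>, a\<rangle> \<in> Z) \<and> p = \<langle>\<langle>w, a\<rangle>, x\<rangle>}"

lemma valuation_in_sets:
  assumes "W \<in> \<S>" "Z \<in> \<S>" shows "valuation \<in> \<S>"
  using comprehension[of "\<^bold>\<exists>''w''. \<^bold>\<exists>''a''. \<^bold>\<exists>''x''. Var ''w'' \<^bold>\<in> ''W'' \<^bold>\<and>
      (Var ''x'' \<^bold>= Zero \<^bold>\<or> Var ''x'' \<^bold>= One) \<^bold>\<and>
      (Var ''x'' \<^bold>= One \<^bold>\<longleftrightarrow> pair (pair Zero (Var ''w'')) (Var ''a'') \<^bold>\<in> ''Z'') \<^bold>\<and>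
      Var ''p'' \<^bold>= pair (pair (Var ''w'') (Var ''a'')) (Var ''x'')"
      "''p''" "(\<lambda>_. Z)(''W'' := W)" "\<lambda>_. \<zero>"] assms
  by (simp add: valuation_def del: zero_add)

lemma in_valuation:
  "\<langle>\<langle>w, a\<rangle>, x\<rangle> \<in> valuation \<longleftrightarrow>
    w \<in> W \<and> (x = \<one> \<and> truth W Z a w \<or> x = \<zero> \<and> \<not> truth W Z a w)"
  unfolding valuation_def mem_Collect_eq pair_eq truth_def by auto

lemma in_W: "w \<in> W \<and> truth W Z a w \<longleftrightarrow> truth W Z a w"
  by (auto simp: truth_def)

lemma Imp_equation:
  assumes "code_class 4 (cantor a b) c" "w \<in> W"
    and "x = \<one> \<and> truth W Z a w \<or> x = \<zero> \<and> \<not> truth W Z a w"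
      "y = \<one> \<and> truth W Z b w \<or> y = \<zero> \<and> \<not> truth W Z b w" "y' \<oplus> y = \<one>"
      "z = \<one> \<and> truth W Z c w \<or> z = \<zero> \<and> \<not> truth W Z c w"
  shows "z \<oplus> x \<otimes> y' = \<one>"
  using Imp_clause[OF assms(1), of w] assms(2-) by auto

text \<open>The clause with the position quantified after the path condition, the form in which the
  satisfaction of \<open>ctl_valuation\<close> presents it.\<close>

lemma EU_clause':
  assumes "code_class 0 (cantor a b \<oplus> numeral_val 2) c" "w \<in> W"
  shows "truth W Z c w \<longleftrightarrow> (\<exists>f\<in>\<S>. is_path W R w f \<and> (\<exists>i.
    (\<forall>j. j \<prec> i \<longrightarrow> (\<forall>x. \<langle>j, x\<rangle> \<in> f \<longrightarrow> truth W Z a x)) \<and> (\<forall>x. \<langle>i, x\<rangle> \<in> f \<longrightarrow> truth W Z b x)))"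
  using EU_clause[OF assms(1), of w] assms(2) by simp

lemma sat_ctl_valuation:
  assumes "E ''W'' = W" "E ''R'' = R" "E ''V'' = valuation"
  shows "sat M e E ctl_valuation"
  apply (simp add: assms ctl_valuation_def function01_def val_def Let_def sat_code_simps in_valuation
      del: zero_add add_zero mult_zero zero_mult numeral_val.simps)
  apply (simp only: in_W)
  apply (intro conjI allI impI)
  subgoal for p unfolding valuation_def by blast
  subgoal by blast
  subgoal by blast
  subgoal by (rule zero_clause)
  subgoal by (elim conjE, rule Imp_equation) assumption+
  subgoal by (simp add: AX_clause del: numeral_val.simps)
  subgoal by (simp add: EG_clause del: numeral_val.simps)
  subgoal by (rule EU_clause')
  done

text \<open>The clause for variables mentions the value 1 only. Since \<open>v\<close> is
  single-valued with values 0 and 1, a value 0 in \<open>v\<close> excludes the value 1, so the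
  variable is false and the valuation gives 0 as well.\<close>

lemma sat_extends:
  assumes E: "E ''W'' = W" "E ''v'' = v" "E ''V'' = valuation"
    and v: "sat M e E (function01 ''v'' (is_Prop (Var ''a'')))"
  shows "sat M e E extends"
proof -
  have v1: "\<exists>w k x. w \<in> W \<and> (x = \<zero> \<or> x = \<one>) \<and> p = \<langle>\<langle>w, numeral_val 5 \<otimes> k \<oplus> \<one>\<rangle>, x\<rangle>"
    if "p \<in> v" for p
    using v E that by (simp add: function01_def Let_def sat_code_simps del: numeral_val.simps) blast
  have v3: "x = y" if "\<langle>\<langle>w, a\<rangle>, x\<rangle> \<in> v" "\<langle>\<langle>w, a\<rangle>, y\<rangle> \<in> v" for w a x y
    using v E that by (simp add: function01_def Let_def sat_code_simps del: numeral_val.simps)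
  have "p \<in> valuation" if p: "p \<in> v" for p
  proof -
    obtain w k x where w: "w \<in> W" and x: "x = \<zero> \<or> x = \<one>"
      and p_eq: "p = \<langle>\<langle>w, numeral_val 5 \<otimes> k \<oplus> \<one>\<rangle>, x\<rangle>" using v1[OF p] by blast
    have "x = \<one> \<longleftrightarrow> \<langle>\<langle>w, numeral_val 5 \<otimes> k \<oplus> \<one>\<rangle>, \<one>\<rangle> \<in> v"
      using v3 p unfolding p_eq by blast
    then have "x = \<one> \<longleftrightarrow> truth W Z (numeral_val 5 \<otimes> k \<oplus> \<one>) w"
      using Prop_clause[of k w] w by simp
    then show ?thesis unfolding p_eq in_valuation using w x by blast
  qed
  then show ?thesis using E by (simp add: extends_def)
qed

end

lemma (in model) sat_valuation_extension_lemma: "sat M e E valuation_extension_lemma"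
proof -
  have "\<exists>V\<in>\<S>. sat M e (E(''W'' := W, ''R'' := R, ''v'' := v, ''V'' := V)) ctl_valuation \<and>
      sat M e (E(''W'' := W, ''R'' := R, ''v'' := v, ''V'' := V)) extends"
    if sets: "W \<in> \<S>" "R \<in> \<S>" "v \<in> \<S>"
      and v: "sat M e (E(''W'' := W, ''R'' := R, ''v'' := v)) (function01 ''v'' (is_Prop (Var ''a'')))"
    for W R v
  proof -
    obtain Z where Z: "Z \<in> \<S>" and "truth_set M W R v Z" using ex_truth_set[OF sets] by blast
    then interpret truth_set M W R v Z by simp
    let ?E = "E(''W'' := W, ''R'' := R, ''v'' := v, ''V'' := valuation)"
    have "sat M e ?E (function01 ''v'' (is_Prop (Var ''a'')))"
      using v by (simp add: function01_def Let_def sat_code_simps del: numeral_val.simps)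
    then show ?thesis
      using sat_ctl_valuation[of ?E] sat_extends[of ?E] valuation_in_sets[OF sets(1) Z]
      by (intro bexI[of _ valuation]) simp_all
  qed
  then show ?thesis by (simp add: valuation_extension_lemma_def)
qed

theorem corollary3p11:
  shows "Sigma12_DC0 \<turnstile> valuation_extension_lemma"
proof -
  \<comment> \<open>Completeness needs axioms free of the Henkin names; the derivation it yields is
    also one from all axioms.\<close>
  let ?T = "{\<phi> \<in> Sigma12_DC0. admissible \<phi>}"
  have closed: "admissible valuation_extension_lemma" "fvN valuation_extension_lemma = {}"
    "fvS valuation_extension_lemma = {}"
    by (auto simp: valuation_extension_lemma_def serial_frame_def function01_def is_Prop_def
        ctl_valuation_def val_def is_Imp_def is_EU_def code_AX_def code_EG_def extends_def Let_def fv_path)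
  have "?T \<turnstile> valuation_extension_lemma"
  proof (rule completeness[OF infinite_reserved])
    show "basic_axioms \<subseteq> ?T"
      by (auto simp: Sigma12_DC0_def ACA0_def basic_axioms_def Let_def)
    fix M :: "nat interp" and e and E :: "name \<Rightarrow> nat set"
    assume T: "\<And>\<psi> e E. \<psi> \<in> ?T \<Longrightarrow> (\<And>X. E X \<in> sets_of M) \<Longrightarrow> sat M e E \<psi>"
      and E: "\<And>X. E X \<in> sets_of M"
    interpret model M by unfold_locales (use T E in auto)
    show "sat M e E valuation_extension_lemma" by (rule sat_valuation_extension_lemma)
  qed (use closed in \<open>auto simp: admissible_def\<close>)
  then show ?thesis unfolding provable_def by (rule derives_mono) blast
qed

end
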